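(* Let $A\subseteq\omega$ be noncomputable, and let $\widetilde{\mathcal{R}}(A)=\{m:(\exists n\in A)(2^n\leq m<2^{n+1})\}$. Then $\widetilde{\mathcal{R}}(A)$ is density-1-bounding in the generic degrees.
   Context: A real is a subset of $\omega$, identified with its characteristic function $\omega\to\{0,1\}$. A real $X$ is density-1 if $\lim_{n\to\infty}|X\cap n|/n=1$, where $n=\{0,\dots,n-1\}$. A (time-dependent) partial oracle $(A)$ for a real $A$ is a set of triples $\langle n,x,l\rangle$ with $n,l\in\omega$, $x\in\{0,1\}$, such that $\langle n,x,l\rangle\in(A)$ implies $A(n)=x$, and for every $n,x$ there is at most one $l$ with $\langle n,x,l\rangle\in(A)$. Its domain $\mathrm{dom}((A))$ is the set of $n$ for which some $\langle n,x,l\rangle\in(A)$ exists. A Turing functional $\phi$ uses $(A)$ as an ordinary oracle for this set of triples. A generic oracle for $A$ is a partial oracle for $A$ with density-1 domain. A generic computation of $B$ is a partial function $\psi$ computed by some machine (possibly with an oracle), with density-1 domain, such that $\psi(n)=B(n)$ whenever $\psi(n)\downarrow$. $B$ is generically computable if it has a generic computation without oracle (i.e. by a partial computable function). $B\leq_{\mathrm{g}}A$ ($B$ is uniformly generically reducible to $A$) if there is a single Turing functional $\phi$ such that for every generic oracle $(A)$ for $A$, $\phi^{(A)}$ is a generic computation of $B$. The generic degrees are the equivalence classes induced by $\leq_{\mathrm{g}}$; the zero degree consists of the generically computable reals. A real $A$ is density-1-bounding (in the generic degrees) if there is a density-1 real $B$ that is not generically computable with $B\leq_{\mathrm{g}}A$.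 *)

theory Defs
  imports Complex_Main "HOL-Library.Nat_Bijection"
begin

text \<open>
  Turing functionals are presented as Kleene's mu-recursive programs with queries to an
  oracle set \<open>X\<close> of natural numbers. Programs act on argument lists; a program applied to a
  list of the wrong length is undefined or ignores the surplus, which is harmless since the
  lengths of all lists occurring in the evaluation on \<open>[n]\<close> are fixed by the program.
\<close>

datatype prog =
    Zero
  | Succ
  | Proj nat
  | Query
  | Comp prog "prog list"
  | PrimRec prog prog
  | Minim prog

primrec eval :: "prog \<Rightarrow> nat set \<Rightarrow> nat list \<Rightarrow> nat option" where
  "eval Zero X xs = Some 0"
| "eval Succ X xs = (case xs of [] \<Rightarrow> None | x # _ \<Rightarrow> Some (Suc x))"
| "eval (Proj i) X xs = (if i < length xs then Some (xs ! i) else None)"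
| "eval Query X xs = (case xs of [] \<Rightarrow> None | x # _ \<Rightarrow> Some (of_bool (x \<in> X)))"
| "eval (Comp f gs) X xs =
     (let rs = map (\<lambda>g. eval g X xs) gs
      in if None \<in> set rs then None else eval f X (map the rs))"
| "eval (PrimRec f g) X xs =
     (case xs of [] \<Rightarrow> None
      | n # ys \<Rightarrow>
          rec_nat (eval f X ys) (\<lambda>m r. Option.bind r (\<lambda>v. eval g X (m # v # ys))) n)"
| "eval (Minim f) X xs =
     (let zero_at = (\<lambda>y. eval f X (y # xs) = Some 0 \<and>
                         (\<forall>z<y. \<exists>v. eval f X (z # xs) = Some v \<and> v \<noteq> 0))
      in if \<exists>y. zero_at y then Some (THE y. zero_at y) else None)"

primrec oracle_free :: "prog \<Rightarrow> bool" where
  "oracle_free Zero = True"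
| "oracle_free Succ = True"
| "oracle_free (Proj i) = True"
| "oracle_free Query = False"
| "oracle_free (Comp f gs) = (oracle_free f \<and> list_all oracle_free gs)"
| "oracle_free (PrimRec f g) = (oracle_free f \<and> oracle_free g)"
| "oracle_free (Minim f) = oracle_free f"

lemma eval_oracle_free: "oracle_free p \<Longrightarrow> eval p X = eval p Y"
proof (induction p)
  case (Comp f gs)
  then have "map (\<lambda>g. eval g X xs) gs = map (\<lambda>g. eval g Y xs) gs" for xs
    by (auto simp: list_all_iff)
  with Comp show ?case by (simp add: fun_eq_iff del: map_eq_conv)
qed (simp_all add: fun_eq_iff split: list.split)

text \<open>
  A program viewed as a Turing functional: \<open>functional p X\<close> is the partial function
  (with \<open>None\<close> for divergence) computed by \<open>p\<close> with oracle \<open>X\<close>.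
\<close>

definition functional :: "prog \<Rightarrow> nat set \<Rightarrow> nat \<rightharpoonup> nat" where
  "functional p X = (\<lambda>n. eval p X [n])"

text \<open>By \<open>eval_oracle_free\<close> the choice of the empty set below is immaterial.\<close>

definition partial_computable :: "(nat \<rightharpoonup> nat) \<Rightarrow> bool" where
  "partial_computable \<psi> \<longleftrightarrow> (\<exists>p. oracle_free p \<and> \<psi> = functional p {})"

definition computable :: "nat set \<Rightarrow> bool" where
  "computable A \<longleftrightarrow> partial_computable (\<lambda>n. Some (of_bool (n \<in> A)))"

definition density_one :: "nat set \<Rightarrow> bool" where
  "density_one X \<longleftrightarrow> (\<lambda>n. real (card (X \<inter> {..<n})) / real n) \<longlonglongrightarrow> 1"

definition partial_oracle :: "(nat \<times> nat \<times> nat) set \<Rightarrow> nat set \<Rightarrow> bool" where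
  "partial_oracle P A \<longleftrightarrow>
     (\<forall>n x l. (n, x, l) \<in> P \<longrightarrow> x \<in> {0, 1} \<and> x = of_bool (n \<in> A)) \<and>
     (\<forall>n x l l'. (n, x, l) \<in> P \<and> (n, x, l') \<in> P \<longrightarrow> l = l')"

definition oracle_dom :: "(nat \<times> nat \<times> nat) set \<Rightarrow> nat set" where
  "oracle_dom P = {n. \<exists>x l. (n, x, l) \<in> P}"

definition generic_oracle :: "(nat \<times> nat \<times> nat) set \<Rightarrow> nat set \<Rightarrow> bool" where
  "generic_oracle P A \<longleftrightarrow> partial_oracle P A \<and> density_one (oracle_dom P)"

definition triple_encode :: "nat \<times> nat \<times> nat \<Rightarrow> nat" where
  "triple_encode = (\<lambda>(n, x, l). prod_encode (n, prod_encode (x, l)))"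

text \<open>
  Correctness of the values and density of the domain only; that \<open>\<psi>\<close> is computed by a machine
  is added where the notion is used.
\<close>

definition generic_computation :: "(nat \<rightharpoonup> nat) \<Rightarrow> nat set \<Rightarrow> bool" where
  "generic_computation \<psi> B \<longleftrightarrow>
     density_one (dom \<psi>) \<and> (\<forall>n\<in>dom \<psi>. \<psi> n = Some (of_bool (n \<in> B)))"

definition generically_computable :: "nat set \<Rightarrow> bool" where
  "generically_computable B \<longleftrightarrow> (\<exists>\<psi>. partial_computable \<psi> \<and> generic_computation \<psi> B)"

definition generic_reducible :: "nat set \<Rightarrow> nat set \<Rightarrow> bool"  (infix "\<le>\<^sub>g" 50) where
  "B \<le>\<^sub>g A \<longleftrightarrow>
     (\<exists>p. \<forall>P. generic_oracle P A \<longrightarrow>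
        generic_computation (functional p (triple_encode ` P)) B)"

definition density_one_bounding :: "nat set \<Rightarrow> bool" where
  "density_one_bounding A \<longleftrightarrow>
     (\<exists>B. density_one B \<and> \<not> generically_computable B \<and> B \<le>\<^sub>g A)"

definition R_tilde :: "nat set \<Rightarrow> nat set" where
  "R_tilde A = {m. \<exists>n\<in>A. 2 ^ n \<le> m \<and> m < 2 ^ (n + 1)}"

end

theory Submission
  imports Defs
begin

text \<open>
  Divide the positive numbers into rows, row \<open>e\<close> being the numbers exactly divisible by \<open>2 ^ e\<close>,
  and into blocks \<open>{2 ^ n..<2 ^ (n + 1)}\<close>. A density-1 set meets almost all blocks of every row,
  and a set containing almost all blocks of every row has density 1. Each block \<open>n\<close> of row \<open>e\<close>
  computably receives a finite string, and \<open>B\<close> omits the block if and only if \<open>A\<close> extends it.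
  A generic oracle for \<open>R_tilde A\<close> knows almost all bits of \<open>A\<close>, so the block may be enumerated as
  soon as a disagreement is seen.

  Say that a block is touched when the \<open>e\<close>-th program enumerates an element of it. The strings
  avoid, as long as possible, the reals extending a string of a touched block; their lengths tend
  to infinity unless almost all blocks of the row are touched, in which case they are bounded
  infinitely often. In the latter case the strings of touched blocks must eventually cover all
  reals, so that the program enumerates an element outside \<open>B\<close>. If they do not cover all reals, the
  strings converge to an uncovered real \<open>Z\<close> that is computable in the limit, and \<open>B\<close> omits only
  finitely many blocks of the row if \<open>Z\<close> and \<open>A\<close> differ at infinitely many places. This is clear if
  \<open>A\<close> is not limit computable. Otherwise the strings are chosen to differ from an approximation to
  \<open>A\<close> wherever an uncovered real permits it; if \<open>Z\<close> differed from \<open>A\<close> at only finitely many places,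
  it would be the only uncovered real extending some string, hence computable, and so would \<open>A\<close>.
\<close>

section \<open>Total computable functions on coded types\<close>

text \<open>Only injectivity is required, so that \<open>bool\<close> can be coded by 0 and 1. Where
  every number has to be decoded, surjectivity is proved for the type at hand.\<close>

class coded =
  fixes enc :: "'a \<Rightarrow> nat"
  assumes inj_enc: "inj enc"
begin

lemma enc_eq_iff [simp]: "enc x = enc y \<longleftrightarrow> x = y"
  using inj_enc by (auto simp: inj_def)

end

instantiation nat :: coded
begin
definition enc_nat [simp]: "enc n = (n :: nat)"
instance by standard (auto simp: inj_def)
end

instantiation bool :: coded
begin
definition enc_bool: "enc b = (of_bool b :: nat)"
instance by standard (auto simp: inj_def enc_bool split: if_splits)
end

instantiation prod :: (coded, coded) coded
begin
definition enc_prod: "enc p = prod_encode (enc (fst p), enc (snd p))"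
instance by standard (auto simp: inj_def enc_prod prod_eq_iff)
end

instantiation list :: (coded) coded
begin
definition enc_list: "enc xs = list_encode (map enc xs)"
instance
proof
  have "inj (list_encode \<circ> map (enc :: 'a \<Rightarrow> nat))"
    by (rule inj_compose[OF inj_list_encode inj_mapI[OF inj_enc]])
  moreover have "list_encode \<circ> map enc = (enc :: 'a list \<Rightarrow> nat)"
    by (rule ext) (simp only: enc_list o_apply)
  ultimately show "inj (enc :: 'a list \<Rightarrow> nat)"
    by (simp only:)
qed
end

lemma enc_Pair: "enc (x, y) = prod_encode (enc x, enc y)"
  by (simp add: enc_prod)

lemma enc_Nil: "enc [] = 0"
  by (simp add: enc_list)

lemma enc_Cons: "enc (x # xs) = Suc (prod_encode (enc x, enc xs))"
  by (simp add: enc_list)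

lemma surj_enc_nat: "surj (enc :: nat \<Rightarrow> nat)"
  by (simp add: surj_def)

lemma surj_enc_prod:
  assumes "surj (enc :: 'a::coded \<Rightarrow> nat)" "surj (enc :: 'b::coded \<Rightarrow> nat)"
  shows "surj (enc :: 'a \<times> 'b \<Rightarrow> nat)"
  unfolding surj_def
proof
  fix n
  obtain a :: 'a and b :: 'b where "enc a = fst (prod_decode n)" "enc b = snd (prod_decode n)"
    using assms by (metis surjD)
  then have "n = enc (a, b)" by (simp add: enc_Pair)
  then show "\<exists>x. n = enc (x :: 'a \<times> 'b)" by blast
qed

lemma surj_enc_list:
  assumes "surj (enc :: 'a::coded \<Rightarrow> nat)"
  shows "surj (enc :: 'a list \<Rightarrow> nat)"
  unfolding surj_def
proof
  fix n
  have "map enc (map (inv enc) (list_decode n) :: 'a list) = list_decode n"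
    using assms by (simp add: comp_def surj_f_inv_f)
  then have "n = enc (map (inv enc) (list_decode n) :: 'a list)"
    by (simp add: enc_list)
  then show "\<exists>x. n = enc (x :: 'a list)" by blast
qed

section \<open>Programs for arithmetic and pairing\<close>

text \<open>Nothing is demanded on numbers that code no element; there \<open>p\<close> may
  diverge.\<close>

definition computes :: "prog \<Rightarrow> ('a::coded \<Rightarrow> 'b::coded) \<Rightarrow> bool" where
  "computes p f \<longleftrightarrow> oracle_free p \<and> (\<forall>X x. eval p X [enc x] = Some (enc (f x)))"

definition recfun :: "('a::coded \<Rightarrow> 'b::coded) \<Rightarrow> bool" where
  "recfun f \<longleftrightarrow> (\<exists>p. computes p f)"

definition const_prog :: "nat \<Rightarrow> prog" where
  "const_prog n = ((\<lambda>p. Comp Succ [p]) ^^ n) Zero"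

lemma const_prog [simp]: "eval (const_prog n) X xs = Some n" "oracle_free (const_prog n)"
  unfolding const_prog_def by (induction n) auto

definition "add_prog = PrimRec (Proj 0) (Comp Succ [Proj 1])"
definition "pred_prog = PrimRec Zero (Proj 0)"
text \<open>Recursion runs on the first argument, hence the arguments are swapped: the second minus
  the first.\<close>

definition "minus_prog = PrimRec (Proj 0) (Comp pred_prog [Proj 1])"
definition "triangle_prog = PrimRec Zero (Comp add_prog [Proj 1, Comp Succ [Proj 0]])"
definition "pair_prog = Comp add_prog [Comp triangle_prog [Comp add_prog [Proj 0, Proj 1]], Proj 0]"

lemma add_prog [simp]: "eval add_prog X [m, n] = Some (m + n)" "oracle_free add_prog"
  unfolding add_prog_def by (induction m) auto

lemma pred_prog [simp]: "eval pred_prog X [n] = Some (n - 1)" "oracle_free pred_prog"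
  unfolding pred_prog_def by (induction n) auto

lemma minus_prog [simp]: "eval minus_prog X [m, n] = Some (n - m)" "oracle_free minus_prog"
  unfolding minus_prog_def by (induction m) auto

lemma triangle_prog [simp]: "eval triangle_prog X [n] = Some (triangle n)" "oracle_free triangle_prog"
  unfolding triangle_prog_def by (induction n) auto

lemma pair_prog [simp]:
  "eval pair_prog X [m, n] = Some (prod_encode (m, n))" "oracle_free pair_prog"
  unfolding pair_prog_def by (auto simp: prod_encode_def)

lemma eval_Minim_total:
  assumes "\<And>y. eval p X (y # xs) = Some (f y)"
  shows "eval (Minim p) X xs = (if \<exists>y. f y = 0 then Some (LEAST y. f y = 0) else None)"
proof -
  define Z where "Z y \<longleftrightarrow> f y = 0 \<and> (\<forall>z<y. f z \<noteq> 0)" for y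
  have "eval (Minim p) X xs = (if \<exists>y. Z y then Some (THE y. Z y) else None)"
    by (simp add: assms Let_def Z_def)
  moreover have "Z y \<longleftrightarrow> (\<exists>y. f y = 0) \<and> y = (LEAST y. f y = 0)" for y
    unfolding Z_def by (metis (mono_tags, lifting) LeastI Least_equality linorder_not_le not_less_Least)
  ultimately show ?thesis by auto
qed

text \<open>The index of the antidiagonal on which the pair coded by \<open>z\<close> lies.\<close>

definition "diag_prog =
  Minim (Comp minus_prog [Comp triangle_prog [Comp Succ [Proj 0]], Comp Succ [Proj 1]])"
definition "fst_prog = Comp minus_prog [Comp triangle_prog [diag_prog], Proj 0]"
definition "snd_prog = Comp minus_prog [fst_prog, diag_prog]"

lemma triangle_mono: "m \<le> n \<Longrightarrow> triangle m \<le> triangle n"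
  by (induction n) (auto simp: le_Suc_eq)

text \<open>The code \<open>z = triangle (m + n) + m\<close> lies below
  \<open>triangle (Suc (m + n))\<close> but not below \<open>triangle (m + n)\<close>, so the least
  \<open>s\<close> with \<open>z < triangle (Suc s)\<close> is \<open>m + n\<close>.\<close>

lemma diag_prog [simp]:
  "eval diag_prog X [prod_encode (m, n)] = Some (m + n)" "oracle_free diag_prog"
proof -
  let ?z = "prod_encode (m, n)"
  have "(LEAST s. Suc ?z - triangle (Suc s) = 0) = m + n"
  proof (rule Least_equality)
    fix s
    assume "Suc ?z - triangle (Suc s) = 0"
    then have "\<not> triangle (Suc s) \<le> triangle (m + n)"
      by (simp add: prod_encode_def)
    then show "m + n \<le> s"
      using triangle_mono not_less_eq_eq by blast
  qed (simp add: prod_encode_def)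
  moreover have "\<exists>s. Suc ?z - triangle (Suc s) = 0"
    by (rule exI[of _ "m + n"]) (simp add: prod_encode_def)
  ultimately show "eval diag_prog X [?z] = Some (m + n)"
    unfolding diag_prog_def
    by (subst eval_Minim_total[where f = "\<lambda>s. Suc ?z - triangle (Suc s)"]) auto
qed (simp add: diag_prog_def)

lemma fst_prog [simp]: "eval fst_prog X [prod_encode (m, n)] = Some m" "oracle_free fst_prog"
  by (simp_all add: fst_prog_def) (simp add: prod_encode_def)

lemma snd_prog [simp]: "eval snd_prog X [prod_encode (m, n)] = Some n" "oracle_free snd_prog"
  by (simp_all add: snd_prog_def)

lemma fst_prog_decode: "eval fst_prog X [n] = Some (fst (prod_decode n))"
  by (metis fst_prog(1) prod.collapse prod_decode_inverse)

lemma snd_prog_decode: "eval snd_prog X [n] = Some (snd (prod_decode n))"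
  by (metis snd_prog(1) prod.collapse prod_decode_inverse)

section \<open>Closure properties of the total computable functions\<close>

named_theorems recfun_intros

lemma recfunI: "oracle_free p \<Longrightarrow> (\<And>X x. eval p X [enc x] = Some (enc (f x))) \<Longrightarrow> recfun f"
  by (auto simp: recfun_def computes_def)

lemma recfunE:
  assumes "recfun f"
  obtains p where "oracle_free p" "\<And>X x. eval p X [enc x] = Some (enc (f x))"
  using assms by (auto simp: recfun_def computes_def)

lemma recfun_comp: "recfun f \<Longrightarrow> recfun g \<Longrightarrow> recfun (\<lambda>x. f (g x))"
proof (elim recfunE)
  fix p q
  assume "oracle_free p" "oracle_free q"
    "\<And>X x. eval p X [enc x] = Some (enc (f x))" "\<And>X x. eval q X [enc x] = Some (enc (g x))"
  then show ?thesis by (intro recfunI[of "Comp p [q]"]) auto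
qed

lemma recfun_id [recfun_intros]: "recfun (\<lambda>x. x)"
  by (rule recfunI[of "Proj 0"]) auto

lemma recfun_const [recfun_intros]: "recfun (\<lambda>x. c)"
  by (rule recfunI[of "const_prog (enc c)"]) auto

lemma recfun_Pair [recfun_intros]:
  assumes "recfun f" "recfun g"
  shows "recfun (\<lambda>x. (f x, g x))"
  using assms
proof (elim recfunE)
  fix p q
  assume "oracle_free p" "oracle_free q"
    "\<And>X x. eval p X [enc x] = Some (enc (f x))" "\<And>X x. eval q X [enc x] = Some (enc (g x))"
  then show ?thesis by (intro recfunI[of "Comp pair_prog [p, q]"]) (auto simp: enc_Pair)
qed

lemma recfun_fst [recfun_intros]: "recfun f \<Longrightarrow> recfun (\<lambda>x. fst (f x))"
  by (rule recfun_comp[of fst], rule recfunI[of fst_prog]) (auto simp: enc_prod)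

lemma recfun_snd [recfun_intros]: "recfun f \<Longrightarrow> recfun (\<lambda>x. snd (f x))"
  by (rule recfun_comp[of snd], rule recfunI[of snd_prog]) (auto simp: enc_prod)

text \<open>Functions of several arguments are computed on nested pairs. This rule and its analogues
  below break a curried application into its arguments.\<close>

lemma recfun_comp2:
  assumes "recfun (\<lambda>z. f (fst z) (snd z))" "recfun g" "recfun h"
  shows "recfun (\<lambda>x. f (g x) (h x))"
  using recfun_comp[OF assms(1) recfun_Pair[OF assms(2,3)]] by simp

lemma recfun_comp3:
  assumes "recfun (\<lambda>z. f (fst z) (fst (snd z)) (snd (snd z)))" "recfun g" "recfun h" "recfun k"
  shows "recfun (\<lambda>x. f (g x) (h x) (k x))"
  using recfun_comp[OF assms(1) recfun_Pair[OF assms(2) recfun_Pair[OF assms(3,4)]]] by simp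

lemma recfun_comp4:
  assumes "recfun (\<lambda>z. f (fst z) (fst (snd z)) (fst (snd (snd z))) (snd (snd (snd z))))"
    "recfun g" "recfun h" "recfun k" "recfun l"
  shows "recfun (\<lambda>x. f (g x) (h x) (k x) (l x))"
  using recfun_comp[OF assms(1)
      recfun_Pair[OF assms(2) recfun_Pair[OF assms(3) recfun_Pair[OF assms(4,5)]]]]
  by simp

lemma recfun_enc [recfun_intros]: "recfun f \<Longrightarrow> recfun (\<lambda>x. enc (f x))"
  unfolding recfun_def computes_def by simp

text \<open>Since \<open>enc\<close> is the identity on numbers, claims on structured values reduce
  to claims on their codes.\<close>

lemma recfun_of_enc: "recfun (\<lambda>x. enc (f x)) \<Longrightarrow> recfun f"
  unfolding recfun_def computes_def by simp

lemma recfun_inv_enc: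
  assumes "surj (enc :: 'b::coded \<Rightarrow> nat)" "recfun f"
  shows "recfun (\<lambda>x. inv (enc :: 'b \<Rightarrow> nat) (f x))"
  by (rule recfun_of_enc) (simp only: surj_f_inv_f[OF assms(1)] assms(2))

lemma recfun_rec_nat [recfun_intros]:
  assumes "recfun a" "recfun (\<lambda>z. g (fst z) (fst (snd z)) (snd (snd z)))" "recfun b"
  shows "recfun (\<lambda>x. rec_nat (a x) (g x) (b x))"
proof -
  obtain p where p: "oracle_free p" "\<And>X x. eval p X [enc x] = Some (enc (a x))"
    by (rule recfunE[OF assms(1)], rule that)
  obtain q where q: "oracle_free q"
    "\<And>X x. eval q X [enc x] = Some (enc (g (fst x) (fst (snd x)) (snd (snd x))))"
    by (rule recfunE[OF assms(2)], rule that)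
  obtain r where r: "oracle_free r" "\<And>X x. eval r X [enc x] = Some (enc (b x))"
    by (rule recfunE[OF assms(3)], rule that)
  \<comment> \<open>\<open>PrimRec\<close> supplies index, previous value and parameter in this
    order, whereas \<open>q\<close> expects the code of parameter, index and value.\<close>
  let ?step = "Comp q [Comp pair_prog [Proj 2, Comp pair_prog [Proj 0, Proj 1]]]"
  have step: "eval ?step X [n, enc v, enc x] = Some (enc (g x n v))" for X n v x
    using q(2)[of X "(x, n, v)"] by (simp add: enc_Pair)
  have "eval (PrimRec p ?step) X [n, enc x] = Some (enc (rec_nat (a x) (g x) n))" for X n x
    by (induction n) (use p step in \<open>simp_all del: eval.simps(5)\<close>)
  then show ?thesis
    using p r q by (intro recfunI[of "Comp (PrimRec p ?step) [r, Proj 0]"])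
      (auto simp del: eval.simps(6))
qed

lemma recfun_Suc [recfun_intros]: "recfun f \<Longrightarrow> recfun (\<lambda>x. Suc (f x))"
  by (rule recfun_comp[of Suc], rule recfunI[of Succ]) auto

lemma recfun_plus [recfun_intros]: "recfun f \<Longrightarrow> recfun g \<Longrightarrow> recfun (\<lambda>x. f x + g x :: nat)"
proof -
  assume "recfun f" "recfun g"
  then have "recfun (\<lambda>x. rec_nat (g x) (\<lambda>_ r. Suc r) (f x))"
    by (intro recfun_intros)
  moreover have "rec_nat n (\<lambda>_ r. Suc r) m = m + n" for m n by (induction m) auto
  ultimately show ?thesis by simp
qed

text \<open>Primitive recursion on the code 0 or 1 of the condition acts as a case
  distinction.\<close>

lemma recfun_if [recfun_intros]:
  assumes "recfun c" "recfun f" "recfun g"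
  shows "recfun (\<lambda>x. if c x then f x else g x)"
proof -
  have "recfun (\<lambda>x. rec_nat (g x) (\<lambda>_ _. f x) (enc (c x)))"
    by (intro recfun_intros recfun_comp[OF assms(2)] assms)
  moreover have "rec_nat (g x) (\<lambda>_ _. f x) (enc (c x)) = (if c x then f x else g x)" for x
    by (simp add: enc_bool)
  ultimately show ?thesis by simp
qed

lemma recfun_minus [recfun_intros]: "recfun f \<Longrightarrow> recfun g \<Longrightarrow> recfun (\<lambda>x. f x - g x :: nat)"
proof -
  assume "recfun f" "recfun g"
  then have "recfun (\<lambda>x. rec_nat (f x) (\<lambda>_ r. rec_nat 0 (\<lambda>k _. k) r) (g x))"
    by (intro recfun_intros)
  moreover have "rec_nat 0 (\<lambda>k _. k) r = r - 1" for r by (cases r) auto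
  moreover have "rec_nat n (\<lambda>_ r. r - 1) m = n - m" for m n :: nat by (induction m) auto
  ultimately show ?thesis by simp
qed

lemma recfun_times [recfun_intros]: "recfun f \<Longrightarrow> recfun g \<Longrightarrow> recfun (\<lambda>x. f x * g x :: nat)"
proof -
  assume f: "recfun f" and g: "recfun g"
  have "recfun (\<lambda>x. rec_nat 0 (\<lambda>_ r. r + g x) (f x))"
    by (intro recfun_intros recfun_comp[OF g] f)
  moreover have "rec_nat 0 (\<lambda>_ r. r + n) m = m * n" for m n :: nat by (induction m) auto
  ultimately show ?thesis by simp
qed

lemma recfun_power [recfun_intros]: "recfun f \<Longrightarrow> recfun g \<Longrightarrow> recfun (\<lambda>x. f x ^ g x :: nat)"
proof -
  assume f: "recfun f" and g: "recfun g"
  have "recfun (\<lambda>x. rec_nat 1 (\<lambda>_ r. f x * r) (g x))"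
    by (intro recfun_intros recfun_comp[OF f] g)
  moreover have "rec_nat 1 (\<lambda>_ r. n * r) m = n ^ m" for m n :: nat by (induction m) auto
  ultimately show ?thesis by simp
qed

lemma recfun_not [recfun_intros]: "recfun P \<Longrightarrow> recfun (\<lambda>x. \<not> P x)"
  using recfun_if[OF _ recfun_const recfun_const, of P False True] by (simp add: if_bool_eq_conj)

lemma recfun_conj [recfun_intros]: "recfun P \<Longrightarrow> recfun Q \<Longrightarrow> recfun (\<lambda>x. P x \<and> Q x)"
  using recfun_if[OF _ _ recfun_const, of P Q False] by (simp add: if_bool_eq_disj)

lemma recfun_disj [recfun_intros]: "recfun P \<Longrightarrow> recfun Q \<Longrightarrow> recfun (\<lambda>x. P x \<or> Q x)"
  using recfun_if[OF _ recfun_const, of P Q True] by (simp add: if_bool_eq_conj disj_imp)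

lemma recfun_imp [recfun_intros]: "recfun P \<Longrightarrow> recfun Q \<Longrightarrow> recfun (\<lambda>x. P x \<longrightarrow> Q x)"
  unfolding imp_conv_disj by (intro recfun_intros)

lemma recfun_eq_0: "recfun f \<Longrightarrow> recfun (\<lambda>x. f x = (0 :: nat))"
proof -
  assume "recfun f"
  then have "recfun (\<lambda>x. rec_nat True (\<lambda>_ _. False) (f x))"
    by (intro recfun_intros)
  moreover have "rec_nat True (\<lambda>_ _. False) n = (n = 0)" for n by (cases n) auto
  ultimately show ?thesis by simp
qed

lemma recfun_le [recfun_intros]: "recfun f \<Longrightarrow> recfun g \<Longrightarrow> recfun (\<lambda>x. f x \<le> (g x :: nat))"
  using recfun_eq_0[of "\<lambda>x. f x - g x"] by (auto intro: recfun_intros)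

lemma recfun_less [recfun_intros]: "recfun f \<Longrightarrow> recfun g \<Longrightarrow> recfun (\<lambda>x. f x < (g x :: nat))"
  unfolding Suc_le_eq[symmetric] by (intro recfun_intros)

lemma recfun_eq [recfun_intros]:
  assumes "recfun f" "recfun g"
  shows "recfun (\<lambda>x. f x = g x)"
proof -
  have "recfun (\<lambda>x. enc (f x) \<le> enc (g x) \<and> enc (g x) \<le> enc (f x))"
    by (intro recfun_intros assms)
  then show ?thesis by (simp flip: order.eq_iff)
qed

lemma recfun_ex_less [recfun_intros]:
  fixes f :: "'a::coded \<Rightarrow> nat"
  assumes "recfun (\<lambda>z. P (fst z) (snd z))" "recfun f"
  shows "recfun (\<lambda>x. \<exists>i<f x. P x i)"
proof -
  have "recfun (\<lambda>x. rec_nat False (\<lambda>i r. r \<or> P x i) (f x))"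
    by (intro recfun_intros recfun_comp2[OF assms(1)] assms(2))
  moreover have "rec_nat False (\<lambda>i r. r \<or> P x i) n = (\<exists>i<n. P x i)" for x n
    by (induction n) (auto simp: less_Suc_eq)
  ultimately show ?thesis by simp
qed

lemma recfun_all_less [recfun_intros]:
  fixes f :: "'a::coded \<Rightarrow> nat"
  assumes "recfun (\<lambda>z. P (fst z) (snd z))" "recfun f"
  shows "recfun (\<lambda>x. \<forall>i<f x. P x i)"
proof -
  have "recfun (\<lambda>x. \<not> (\<exists>i<f x. \<not> P x i))"
    by (intro recfun_intros assms)
  then show ?thesis by simp
qed

text \<open>The program for the negation vanishes exactly where \<open>P\<close> holds, and the
  existence of witnesses makes the unbounded search total.\<close>

lemma recfun_Least:
  fixes P :: "'a::coded \<Rightarrow> nat \<Rightarrow> bool"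
  assumes "recfun (\<lambda>z. P (fst z) (snd z))" "\<And>x. \<exists>n. P x n"
  shows "recfun (\<lambda>x. LEAST n. P x n)"
proof -
  have "recfun (\<lambda>z. \<not> P (fst z) (snd z))"
    by (intro recfun_intros assms(1))
  then obtain p where p: "oracle_free p"
    "\<And>X x. eval p X [enc x] = Some (of_bool (\<not> P (fst x) (snd x)))"
    by (elim recfunE) (simp add: enc_bool)
  let ?q = "Comp p [Comp pair_prog [Proj 1, Proj 0]]"
  have "eval ?q X [n, enc x] = Some (of_bool (\<not> P x n))" for X n x
    using p(2)[of X "(x, n)"] by (simp add: enc_Pair)
  from eval_Minim_total[OF this] have "eval (Minim ?q) X [enc x] = Some (LEAST n. P x n)" for X x
    using assms(2)[of x] by (simp del: eval.simps)
  then show ?thesis using p(1) by (intro recfunI[of "Minim ?q"]) (auto simp del: eval.simps(7))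
qed

lemma recfun_div [recfun_intros]:
  assumes "recfun f" "recfun g"
  shows "recfun (\<lambda>x. f x div g x :: nat)"
proof -
  \<comment> \<open>The disjunct \<open>n = 0\<close> ends the search at 0, in accordance with
    \<open>m div 0 = 0\<close>.\<close>
  have div: "m div n = (LEAST q. m < Suc q * n \<or> n = 0)" for m n :: nat
  proof (cases "n = 0")
    case False
    then have "m < Suc q * n \<longleftrightarrow> m div n \<le> q" for q
      by (simp add: div_less_iff_less_mult flip: less_Suc_eq_le)
    moreover have "(LEAST q. m div n \<le> q) = m div n"
      by (rule Least_equality) auto
    ultimately show ?thesis
      by (simp add: False del: mult_Suc)
  qed simp
  have "\<exists>q. m < Suc q * n \<or> n = 0" for m n :: nat
    by (rule exI[of _ m], cases n) auto
  then show ?thesis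
    unfolding div
    by (intro recfun_Least recfun_intros recfun_comp[OF assms(1)] recfun_comp[OF assms(2)])
qed

lemma recfun_mod [recfun_intros]:
  "recfun f \<Longrightarrow> recfun g \<Longrightarrow> recfun (\<lambda>x. f x mod g x :: nat)"
  unfolding minus_div_mult_eq_mod[symmetric] by (intro recfun_intros)

lemma recfun_even [recfun_intros]: "recfun f \<Longrightarrow> recfun (\<lambda>x. even (f x :: nat))"
  unfolding even_iff_mod_2_eq_zero by (intro recfun_intros)

section \<open>Computable list operations and oracle search\<close>

lemma recfun_Cons [recfun_intros]: "recfun f \<Longrightarrow> recfun g \<Longrightarrow> recfun (\<lambda>x. f x # g x)"
  by (rule recfun_of_enc) (simp add: enc_Cons flip: enc_Pair, intro recfun_intros)

text \<open>The code of a nonempty list is the successor of a pair, so the recursion index in the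
  last step of a primitive recursion is that pair.\<close>

lemma recfun_hd [recfun_intros]: "recfun f \<Longrightarrow> recfun (\<lambda>x. hd (f x))"
proof (rule recfun_comp[of hd])
  let ?p = "PrimRec (const_prog (enc (hd [] :: 'b))) (Comp fst_prog [Proj 0])"
  have "eval ?p X [enc xs] = Some (enc (hd xs))" for X and xs :: "'b list"
  proof (cases xs)
    case (Cons y ys)
    \<comment> \<open>The recursive value is discarded, but the evaluation passes through all
      smaller numbers and has to converge on each.\<close>
    have "\<exists>v. eval ?p X [n] = Some v" for n
      by (induction n) (auto simp: fst_prog_decode)
    then obtain v where "eval ?p X [prod_encode (enc y, enc ys)] = Some v" by blast
    then show ?thesis by (simp add: Cons enc_Cons)
  qed (simp add: enc_Nil)
  then show "recfun (hd :: 'b list \<Rightarrow> 'b)"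
    by (intro recfunI[of ?p]) (simp_all del: eval.simps)
qed

lemma recfun_tl [recfun_intros]: "recfun f \<Longrightarrow> recfun (\<lambda>x. tl (f x))"
proof (rule recfun_comp[of tl])
  let ?p = "PrimRec (const_prog 0) (Comp snd_prog [Proj 0])"
  have "eval ?p X [enc xs] = Some (enc (tl xs))" for X and xs :: "'b list"
  proof (cases xs)
    case (Cons y ys)
    have "\<exists>v. eval ?p X [n] = Some v" for n
      by (induction n) (auto simp: snd_prog_decode)
    then obtain v where "eval ?p X [prod_encode (enc y, enc ys)] = Some v" by blast
    then show ?thesis by (simp add: Cons enc_Cons)
  qed (simp add: enc_Nil)
  then show "recfun (tl :: 'b list \<Rightarrow> 'b list)"
    by (intro recfunI[of ?p]) (simp_all del: eval.simps)
qed

lemma recfun_case_list [recfun_intros]: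
  assumes "recfun l" "recfun a" "recfun (\<lambda>z. g (fst z) (fst (snd z)) (snd (snd z)))"
  shows "recfun (\<lambda>x. case l x of [] \<Rightarrow> a x | y # ys \<Rightarrow> g x y ys)"
proof -
  have "recfun (\<lambda>x. if l x = [] then a x else g x (hd (l x)) (tl (l x)))"
    by (intro recfun_intros recfun_comp3[OF assms(3)] assms(1,2))
  moreover have "(if l x = [] then a x else g x (hd (l x)) (tl (l x))) =
      (case l x of [] \<Rightarrow> a x | y # ys \<Rightarrow> g x y ys)" for x
    by (cases "l x") auto
  ultimately show ?thesis by simp
qed

lemma length_le_enc: "length xs \<le> enc xs"
proof (induction xs)
  case (Cons x xs)
  then show ?case
    using le_prod_encode_2[of "enc xs" "enc x"] by (simp add: enc_Cons)
qed simp

text \<open>The state consists of the accumulator and the remaining list. The code of the list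
  bounds its length, and surplus steps change nothing.\<close>

lemma recfun_foldl [recfun_intros]:
  assumes "recfun (\<lambda>z. g (fst z) (fst (snd z)) (snd (snd z)))" "recfun a" "recfun l"
  shows "recfun (\<lambda>x. foldl (g x) (a x) (l x))"
proof -
  let ?step = "\<lambda>x _ s. case snd s of [] \<Rightarrow> s | y # ys \<Rightarrow> (g x (fst s) y, ys)"
  have "rec_nat (b, ys) (?step x) n = (foldl (g x) b (take n ys), drop n ys)" for x b ys n
  proof (induction n)
    case (Suc n)
    then show ?case
      by (cases "n < length ys")
        (simp_all add: take_Suc_conv_app_nth Cons_nth_drop_Suc[symmetric])
  qed simp
  moreover have "recfun (\<lambda>x. fst (rec_nat (a x, l x) (?step x) (enc (l x))))"
    by (intro recfun_intros recfun_comp3[OF assms(1)] assms(2,3))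
  ultimately show ?thesis
    by (simp add: length_le_enc)
qed

lemma recfun_bex_set [recfun_intros]:
  assumes "recfun (\<lambda>z. P (fst z) (snd z))" "recfun l"
  shows "recfun (\<lambda>x. \<exists>y\<in>set (l x). P x y)"
proof -
  have "recfun (\<lambda>x. foldl (\<lambda>b y. b \<or> P x y) False (l x))"
    by (intro recfun_intros recfun_comp2[OF assms(1)] assms(2))
  moreover have "foldl (\<lambda>b y. b \<or> P x y) c ys \<longleftrightarrow> c \<or> (\<exists>y\<in>set ys. P x y)" for x c ys
    by (induction ys arbitrary: c) auto
  ultimately show ?thesis by simp
qed

lemma recfun_member [recfun_intros]:
  assumes "recfun f" "recfun l"
  shows "recfun (\<lambda>x. f x \<in> set (l x))"
proof -
  have "recfun (\<lambda>x. \<exists>y\<in>set (l x). y = f x)"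
    by (intro recfun_intros recfun_comp[OF assms(1)] assms(2))
  then show ?thesis by simp
qed

lemma recfun_drop [recfun_intros]:
  assumes "recfun f" "recfun l"
  shows "recfun (\<lambda>x. drop (f x) (l x))"
proof -
  have "recfun (\<lambda>x. rec_nat (l x) (\<lambda>_ ys. tl ys) (f x))"
    by (intro recfun_intros assms)
  moreover have "rec_nat ys (\<lambda>_ ys. tl ys) n = drop n ys" for ys :: "'b list" and n
    by (induction n) (auto simp: drop_Suc tl_drop)
  ultimately show ?thesis by simp
qed

text \<open>Minimization over \<open>y\<close> with one oracle query per candidate. The test is
  total, so the search diverges only if no candidate is accepted.\<close>

lemma oracle_search:
  assumes "recfun (g :: nat \<times> nat \<Rightarrow> nat)" "recfun (Q :: nat \<times> nat \<times> bool \<Rightarrow> bool)"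
  shows "\<exists>p. \<forall>X m. functional p X m = (if \<exists>y. Q (m, y, g (m, y) \<in> X) then Some 1 else None)"
proof -
  obtain q where q: "\<And>X x. eval q X [enc x] = Some (enc (g x))"
    by (rule recfunE[OF assms(1)], rule that)
  obtain r where r: "\<And>X x. eval r X [enc x] = Some (enc (\<not> Q x))"
    by (rule recfunE[OF recfun_not[OF assms(2)]], rule that)
  let ?pair = "Comp pair_prog [Proj 1, Proj 0]"
  let ?r = "Comp r [Comp pair_prog [Proj 1, Comp pair_prog [Proj 0, Comp Query [Comp q [?pair]]]]]"
  have "eval ?r X [y, m] = Some (of_bool (\<not> Q (m, y, g (m, y) \<in> X)))" for X m y
    using q[of X "(m, y)"] r[of X "(m, y, g (m, y) \<in> X)"] by (simp add: enc_Pair enc_bool)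
  from eval_Minim_total[OF this]
  have "functional (Comp (const_prog 1) [Minim ?r]) X m =
      (if \<exists>y. Q (m, y, g (m, y) \<in> X) then Some 1 else None)" for X m
    by (simp add: functional_def del: eval.simps(7))
  then show ?thesis by blast
qed

lemma recfun_prod_decode [recfun_intros]: "recfun f \<Longrightarrow> recfun (\<lambda>x. prod_decode (f x))"
  by (rule recfun_of_enc) (simp add: enc_prod)

lemma recfun_prod_encode [recfun_intros]: "recfun f \<Longrightarrow> recfun (\<lambda>x. prod_encode (f x))"
  using recfun_enc[of f] by (simp add: enc_prod)

lemma recfun_list_decode [recfun_intros]: "recfun f \<Longrightarrow> recfun (\<lambda>x. list_decode (f x))"
  by (rule recfun_of_enc) (simp add: enc_list map_idI)

lemma recfun_length [recfun_intros]:
  assumes "recfun f"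
  shows "recfun (\<lambda>x. length (f x))"
proof -
  have "recfun (\<lambda>x. foldl (\<lambda>n y. Suc n) 0 (f x))"
    by (intro recfun_intros assms)
  moreover have "foldl (\<lambda>n y. Suc n) k ys = k + length ys" for k and ys :: "'b list"
    by (induction ys arbitrary: k) auto
  ultimately show ?thesis by simp
qed

section \<open>A universal enumeration\<close>

text \<open>Lists of programs get the tags 7 and 8, which no program has, so that facts about the
  arguments of a composition can be derived alongside facts about programs.\<close>

primrec lcode :: "nat list \<Rightarrow> nat" where
  "lcode [] = prod_encode (7, 0)"
| "lcode (c # cs) = prod_encode (8, prod_encode (c, lcode cs))"

primrec code :: "prog \<Rightarrow> nat" where
  "code Zero = prod_encode (0, 0)"
| "code Succ = prod_encode (1, 0)"
| "code (Proj i) = prod_encode (2, i)"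
| "code Query = prod_encode (3, 0)"
| "code (Comp f gs) = prod_encode (4, prod_encode (code f, lcode (map code gs)))"
| "code (PrimRec f g) = prod_encode (5, prod_encode (code f, code g))"
| "code (Minim f) = prod_encode (6, code f)"

abbreviation "tag c \<equiv> fst (prod_decode c)"
abbreviation "arg c \<equiv> snd (prod_decode c)"
abbreviation "arg1 c \<equiv> fst (prod_decode (arg c))"
abbreviation "arg2 c \<equiv> snd (prod_decode (arg c))"

section \<open>Traces of computations\<close>

type_synonym fact = "nat \<times> nat list \<times> nat"

text \<open>
  A fact \<open>(c, xs, v)\<close> asserts that the program with code \<open>c\<close> has value \<open>v\<close> on \<open>xs\<close>, or, if \<open>c\<close> is
  the \<open>lcode\<close> of a list of programs, that \<open>v\<close> codes the list of their values on \<open>xs\<close>.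
  A trace is a list of facts each of which follows from later members of the list.
\<close>

definition justified :: "fact list \<Rightarrow> nat \<Rightarrow> nat list \<Rightarrow> nat \<Rightarrow> bool" where
  "justified fs c xs v \<longleftrightarrow>
     (tag c = 0 \<and> v = 0) \<or>
     (tag c = 1 \<and> (case xs of [] \<Rightarrow> False | x # ys \<Rightarrow> v = Suc x)) \<or>
     (tag c = 2 \<and> (case drop (arg c) xs of [] \<Rightarrow> False | x # ys \<Rightarrow> v = x)) \<or>
     (tag c = 4 \<and> (\<exists>d\<in>set fs. fst d = arg2 c \<and> fst (snd d) = xs \<and>
        (arg1 c, list_decode (snd (snd d)), v) \<in> set fs)) \<or>
     (tag c = 5 \<and> (case xs of [] \<Rightarrow> False | n # ys \<Rightarrow>
        n = 0 \<and> (arg1 c, ys, v) \<in> set fs \<or>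
        0 < n \<and> (\<exists>d\<in>set fs. fst d = c \<and> fst (snd d) = (n - 1) # ys \<and>
          (arg2 c, (n - 1) # snd (snd d) # ys, v) \<in> set fs))) \<or>
     (tag c = 6 \<and> (arg c, v # xs, 0) \<in> set fs \<and>
        (\<forall>z<v. \<exists>d\<in>set fs. fst d = arg c \<and> fst (snd d) = z # xs \<and> snd (snd d) \<noteq> 0)) \<or>
     (tag c = 7 \<and> v = 0) \<or>
     (tag c = 8 \<and> (\<exists>d\<in>set fs. fst d = arg1 c \<and> fst (snd d) = xs \<and>
        (\<exists>d'\<in>set fs. fst d' = arg2 c \<and> fst (snd d') = xs \<and>
          v = Suc (prod_encode (snd (snd d), snd (snd d'))))))"

text \<open>Quantifying over positions keeps the definition within the closure rules for
  \<open>recfun\<close>; \<open>trace_Cons\<close> restores the recursive reading.\<close>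

definition trace :: "fact list \<Rightarrow> bool" where
  "trace fs \<longleftrightarrow> (\<forall>i<length fs. case drop i fs of [] \<Rightarrow> True
     | d # gs \<Rightarrow> justified gs (fst d) (fst (snd d)) (snd (snd d)))"

definition decode_trace :: "nat \<Rightarrow> fact list" where
  "decode_trace = inv enc"

text \<open>Bounding the codes of traces by \<open>s\<close> makes the relation decidable and
  increasing in \<open>s\<close>. The value 1 is the claim that \<open>m\<close> belongs to the
  real.\<close>

definition enumerated :: "nat \<Rightarrow> nat \<Rightarrow> nat \<Rightarrow> bool" where
  "enumerated e m s \<longleftrightarrow> (\<exists>t<s. trace (decode_trace t) \<and> (e, [m], 1) \<in> set (decode_trace t))"

lemma recfun_justified:
  "recfun (\<lambda>z. justified (fst z) (fst (snd z)) (fst (snd (snd z))) (snd (snd (snd z))))"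
  unfolding justified_def by (intro recfun_intros)

lemma recfun_trace: "recfun trace"
  unfolding trace_def by (intro recfun_intros recfun_comp4[OF recfun_justified])

lemma surj_enc_trace: "surj (enc :: fact list \<Rightarrow> nat)"
  by (intro surj_enc_list surj_enc_prod surj_enc_nat)

lemma recfun_enumerated [recfun_intros]:
  assumes "recfun e" "recfun m" "recfun s"
  shows "recfun (\<lambda>x. enumerated (e x) (m x) (s x))"
  unfolding enumerated_def decode_trace_def
  by (intro recfun_intros recfun_comp[OF recfun_trace] recfun_inv_enc[OF surj_enc_trace]
      assms assms[THEN recfun_comp])

lemma enumerated_mono: "enumerated e m s \<Longrightarrow> s \<le> s' \<Longrightarrow> enumerated e m s'"
  unfolding enumerated_def by (meson order_less_le_trans)

lemma trace_Nil [simp]: "trace []"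
  by (simp add: trace_def)

lemma trace_Cons [simp]: "trace ((c, xs, v) # fs) \<longleftrightarrow> justified fs c xs v \<and> trace fs"
  by (simp add: trace_def All_less_Suc2)

text \<open>Membership in the list of facts occurs only positively in
  \<open>justified\<close>.\<close>

lemma justified_mono:
  assumes "justified fs c xs v" "set fs \<subseteq> set gs"
  shows "justified gs c xs v"
proof -
  have "tag c \<in> {0, 1, 2, 7} \<or> tag c = 4 \<or> tag c = 5 \<or> tag c = 6 \<or> tag c = 8"
    using assms(1) unfolding justified_def by blast
  then consider "tag c \<in> {0, 1, 2, 7}" | "tag c = 4" | "tag c = 5" | "tag c = 6" | "tag c = 8"
    by blast
  then show ?thesis
  proof cases
    case 1
    then show ?thesis
      using assms(1) by (elim insertE; simp add: justified_def)
  next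
    case 2
    then show ?thesis using assms by (simp add: justified_def) blast
  next
    case 3
    then show ?thesis using assms by (cases xs; simp add: justified_def) blast
  next
    case 4
    then show ?thesis using assms by (simp add: justified_def) blast
  next
    case 5
    then show ?thesis using assms by (simp add: justified_def) blast
  qed
qed

lemma trace_append: "trace fs \<Longrightarrow> trace gs \<Longrightarrow> trace (fs @ gs)"
  by (induction fs) (auto elim!: justified_mono)

section \<open>Soundness and completeness of derivations\<close>

definition derivable :: "nat \<Rightarrow> nat list \<Rightarrow> nat \<Rightarrow> bool" where
  "derivable c xs v \<longleftrightarrow> (\<exists>fs. trace fs \<and> (c, xs, v) \<in> set fs)"

text \<open>Traces for the premises are concatenated and the new fact is put in front.\<close>

lemma derivable_step:
  assumes "\<forall>(c, xs, v)\<in>set gs. derivable c xs v" "justified gs c xs v"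
  shows "derivable c xs v"
proof -
  have "\<exists>fs. trace fs \<and> set gs \<subseteq> set fs"
    using assms(1)
  proof (induction gs)
    case Nil
    then show ?case by (auto intro: exI[of _ "[]"])
  next
    case (Cons g gs)
    then obtain fs fs' where "trace fs" "set gs \<subseteq> set fs" "trace fs'" "g \<in> set fs'"
      by (auto simp: derivable_def)
    then show ?case
      by (intro exI[of _ "fs @ fs'"]) (auto intro: trace_append)
  qed
  then obtain fs where "trace fs" "set gs \<subseteq> set fs" by blast
  then have "trace ((c, xs, v) # fs)"
    using assms(2) justified_mono by auto
  then show ?thesis
    unfolding derivable_def by (intro exI[of _ "(c, xs, v) # fs"]) auto
qed

lemma eval_Comp_eq_Some:
  "eval (Comp f gs) X xs = Some v \<longleftrightarrow>
    (\<exists>rs. map (\<lambda>g. eval g X xs) gs = map Some rs \<and> eval f X rs = Some v)"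
proof
  assume *: "eval (Comp f gs) X xs = Some v"
  let ?rs = "map the (map (\<lambda>g. eval g X xs) gs)"
  have all: "None \<notin> set (map (\<lambda>g. eval g X xs) gs)" and "eval f X ?rs = Some v"
    using * unfolding eval.simps Let_def by (auto simp only: split: if_splits)
  moreover have "map (\<lambda>g. eval g X xs) gs = map Some ?rs"
    using all by (force simp: image_iff)
  ultimately show "\<exists>rs. map (\<lambda>g. eval g X xs) gs = map Some rs \<and> eval f X rs = Some v"
    by blast
next
  assume "\<exists>rs. map (\<lambda>g. eval g X xs) gs = map Some rs \<and> eval f X rs = Some v"
  then obtain rs where rs: "map (\<lambda>g. eval g X xs) gs = map Some rs" "eval f X rs = Some v"
    by blast
  show "eval (Comp f gs) X xs = Some v"
    unfolding eval.simps Let_def rs(1) using rs(2) by (simp add: image_iff comp_def)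
qed

lemma eval_Minim_eq_Some:
  "eval (Minim f) X xs = Some v \<longleftrightarrow> eval f X (v # xs) = Some 0 \<and>
    (\<forall>z<v. \<exists>w. eval f X (z # xs) = Some w \<and> w \<noteq> 0)"
proof -
  define Z where "Z y \<longleftrightarrow> eval f X (y # xs) = Some 0 \<and>
    (\<forall>z<y. \<exists>w. eval f X (z # xs) = Some w \<and> w \<noteq> 0)" for y
  have "eval (Minim f) X xs = (if \<exists>y. Z y then Some (THE y. Z y) else None)"
    unfolding Z_def eval.simps Let_def ..
  moreover have "y = y'" if "Z y" "Z y'" for y y'
    using that unfolding Z_def by (metis linorder_neqE_nat option.inject)
  ultimately have "eval (Minim f) X xs = Some v \<longleftrightarrow> Z v"
    by (auto intro: theI)
  then show ?thesis by (simp only: Z_def)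
qed

text \<open>Induction along a trace, in which each fact rests on later ones. Programs and lists of
  programs are treated together because of composition; facts about \<open>Query\<close> are never
  justified, as no clause has tag 3.\<close>

lemma derivable_sound:
  assumes "derivable c xs v"
  shows "(\<forall>p. c = code p \<longrightarrow> eval p {} xs = Some v) \<and>
    (\<forall>ps. c = lcode (map code ps) \<longrightarrow> map (\<lambda>p. eval p {} xs) ps = map Some (list_decode v))"
    (is "?P c xs v")
proof -
  have "\<forall>(c, xs, v)\<in>set fs. ?P c xs v" if "trace fs" for fs
    using that
  proof (induction fs)
    case (Cons d fs)
    obtain c xs v where d: "d = (c, xs, v)" by (cases d)
    from Cons have IH: "\<And>c xs v. (c, xs, v) \<in> set fs \<Longrightarrow> ?P c xs v"
      and just: "justified fs c xs v"
      by (auto simp: d)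
    have "eval p {} xs = Some v" if c: "c = code p" for p
    proof (cases p)
      case (Proj i)
      obtain ys where "drop i xs = v # ys"
        using just c by (auto simp: Proj justified_def split: list.splits)
      moreover from this have "i < length xs"
        by (metis drop_eq_Nil list.distinct(1) not_le)
      ultimately show ?thesis
        by (simp add: Proj flip: Cons_nth_drop_Suc)
    next
      case (Comp f gs)
      obtain w where "(lcode (map code gs), xs, w) \<in> set fs" "(code f, list_decode w, v) \<in> set fs"
        using just c by (auto simp: Comp justified_def)
      then show ?thesis
        unfolding Comp eval_Comp_eq_Some using IH by blast
    next
      case (PrimRec f g)
      obtain n ys where xs: "xs = n # ys"
        using just c by (auto simp: PrimRec justified_def split: list.splits)
      show ?thesis
      proof (cases n)
        case 0
        then have "(code f, ys, v) \<in> set fs"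
          using just c by (auto simp: PrimRec xs justified_def)
        then show ?thesis using IH by (auto simp: PrimRec xs 0)
      next
        case (Suc k)
        then obtain w where "(code p, k # ys, w) \<in> set fs" "(code g, k # w # ys, v) \<in> set fs"
          using just c by (auto simp: PrimRec xs justified_def)
        then have "eval p {} (k # ys) = Some w" "eval g {} (k # w # ys) = Some v"
          using IH by blast+
        then show ?thesis by (simp add: PrimRec xs Suc)
      qed
    next
      case (Minim f)
      have "(code f, v # xs, 0) \<in> set fs"
        "\<forall>z<v. \<exists>w. (code f, z # xs, w) \<in> set fs \<and> w \<noteq> 0"
        using just c by (fastforce simp: Minim justified_def)+
      then show ?thesis
        unfolding Minim eval_Minim_eq_Some using IH by blast
    qed (use just c in \<open>auto simp: justified_def split: list.splits\<close>)
    moreover have "map (\<lambda>p. eval p {} xs) ps = map Some (list_decode v)"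
      if c: "c = lcode (map code ps)" for ps
    proof (cases ps)
      case (Cons p ps')
      show ?thesis using just IH c
        by (fastforce simp: Cons justified_def)
    qed (use just c in \<open>auto simp: justified_def\<close>)
    ultimately show ?case using IH by (auto simp: d)
  qed simp
  then show ?thesis using assms unfolding derivable_def by fastforce
qed

lemma derivable_complete: "oracle_free p \<Longrightarrow> eval p {} xs = Some v \<Longrightarrow> derivable (code p) xs v"
proof (induction p arbitrary: xs v)
  case Zero
  then show ?case by (intro derivable_step[of "[]"]) (auto simp: justified_def)
next
  case Succ
  then show ?case by (intro derivable_step[of "[]"]) (auto simp: justified_def split: list.splits)
next
  case (Proj i)
  then show ?case
    by (intro derivable_step[of "[]"])
      (auto simp: justified_def split: list.splits if_splits simp flip: Cons_nth_drop_Suc)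
next
  case (Comp f gs)
  \<comment> \<open>Passing to sublists keeps the induction hypothesis for the members of
    \<open>gs\<close> available.\<close>
  have list: "derivable (lcode (map code hs)) xs (list_encode rs)"
    if "set hs \<subseteq> set gs" "map (\<lambda>g. eval g {} xs) hs = map Some rs" for hs rs
    using that
  proof (induction hs arbitrary: rs)
    case Nil
    then show ?case by (intro derivable_step[of "[]"]) (auto simp: justified_def)
  next
    case (Cons h hs)
    then obtain r rs' where rs: "rs = r # rs'" by auto
    have "derivable (code h) xs r"
      using Cons.prems Comp.prems Comp.IH by (auto simp: rs list_all_iff)
    moreover have "derivable (lcode (map code hs)) xs (list_encode rs')"
      using Cons by (auto simp: rs)
    ultimately show ?case
      by (intro derivable_step[of "[(code h, xs, r), (lcode (map code hs), xs, list_encode rs')]"])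
        (auto simp: justified_def rs)
  qed
  obtain rs where rs: "map (\<lambda>g. eval g {} xs) gs = map Some rs" "eval f {} rs = Some v"
    using Comp.prems(2) unfolding eval_Comp_eq_Some by blast
  then have "derivable (code f) rs v"
    using Comp by auto
  then show ?case
    using list[OF subset_refl rs(1)]
    by (intro derivable_step[of "[(code f, rs, v), (lcode (map code gs), xs, list_encode rs)]"])
      (auto simp: justified_def)
next
  case (PrimRec f g)
  then obtain n ys where xs: "xs = n # ys" by (auto split: list.splits)
  have "derivable (code (PrimRec f g)) (n # ys) v" if "eval (PrimRec f g) {} (n # ys) = Some v" for v n
    using that
  proof (induction n arbitrary: v)
    case 0
    then have "derivable (code f) ys v" using PrimRec by simp
    then show ?case
      by (intro derivable_step[of "[(code f, ys, v)]"]) (auto simp: justified_def)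
  next
    case (Suc n)
    then obtain w where w: "eval (PrimRec f g) {} (n # ys) = Some w" "eval g {} (n # w # ys) = Some v"
      by (auto simp: bind_eq_Some_conv)
    then have "derivable (code g) (n # w # ys) v" "derivable (code (PrimRec f g)) (n # ys) w"
      using PrimRec Suc by auto
    then show ?case
      by (intro derivable_step[of "[(code (PrimRec f g), n # ys, w), (code g, n # w # ys, v)]"])
        (auto simp: justified_def)
  qed
  then show ?case using PrimRec.prems xs by simp
next
  case (Minim f)
  then have Z: "eval f {} (v # xs) = Some 0"
    and "\<forall>z<v. \<exists>w. eval f {} (z # xs) = Some w \<and> w \<noteq> 0"
    unfolding eval_Minim_eq_Some by blast+
  then obtain w where w: "\<And>z. z < v \<Longrightarrow> eval f {} (z # xs) = Some (w z) \<and> w z \<noteq> 0"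
    by metis
  show ?case
    using Z w Minim
    by (intro derivable_step[of "(code f, v # xs, 0) # map (\<lambda>z. (code f, z # xs, w z)) [0..<v]"])
      (auto simp: justified_def)
qed simp

theorem enumerated_code:
  assumes "oracle_free p"
  shows "(\<exists>s. enumerated (code p) m s) \<longleftrightarrow> eval p {} [m] = Some 1"
proof -
  have "(\<exists>s. enumerated (code p) m s) \<longleftrightarrow> derivable (code p) [m] 1"
    unfolding enumerated_def derivable_def decode_trace_def
    by (metis inv_f_f inj_enc lessI)
  then show ?thesis
    using derivable_sound derivable_complete[OF assms] by metis
qed

section \<open>Density\<close>

text \<open>In terms of the complement, intersections become sums of error terms, and no division by
  \<open>n\<close> remains.\<close>

lemma density_one_iff:
  "density_one X \<longleftrightarrow> (\<forall>\<epsilon>>0. \<exists>N. \<forall>n\<ge>N. real (card ({..<n} - X)) \<le> \<epsilon> * real n)"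
proof -
  have dist: "dist (real (card (X \<inter> {..<n})) / real n) 1 = real (card ({..<n} - X)) / real n"
    if "n > 0" for n
  proof -
    have "card ({..<n} - X) + card (X \<inter> {..<n}) = n"
      using card_Int_Diff[of "{..<n}" X] by (simp add: Int_commute)
    then have "real (card (X \<inter> {..<n})) = real n - real (card ({..<n} - X))"
      by linarith
    then show ?thesis using that by (simp add: dist_real_def diff_divide_distrib)
  qed
  show ?thesis
  proof
    assume *: "density_one X"
    show "\<forall>\<epsilon>>0. \<exists>N. \<forall>n\<ge>N. real (card ({..<n} - X)) \<le> \<epsilon> * real n"
    proof (intro allI impI)
      fix \<epsilon> :: real assume "\<epsilon> > 0"
      then obtain N where N: "\<And>n. n \<ge> N \<Longrightarrow> dist (real (card (X \<inter> {..<n})) / real n) 1 < \<epsilon>"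
        using * unfolding density_one_def LIMSEQ_def by meson
      have "real (card ({..<n} - X)) \<le> \<epsilon> * real n" if "n \<ge> Suc N" for n
        using N[of n] dist[of n] that by (simp add: field_simps)
      then show "\<exists>N. \<forall>n\<ge>N. real (card ({..<n} - X)) \<le> \<epsilon> * real n" by blast
    qed
  next
    assume *: "\<forall>\<epsilon>>0. \<exists>N. \<forall>n\<ge>N. real (card ({..<n} - X)) \<le> \<epsilon> * real n"
    show "density_one X"
      unfolding density_one_def LIMSEQ_def
    proof (intro allI impI)
      fix \<epsilon> :: real assume "\<epsilon> > 0"
      then obtain N where N: "\<And>n. n \<ge> N \<Longrightarrow> real (card ({..<n} - X)) \<le> \<epsilon> / 2 * real n"
        using * by (meson half_gt_zero)
      have "dist (real (card (X \<inter> {..<n})) / real n) 1 < \<epsilon>" if "n \<ge> Suc N" for n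
      proof -
        have "real (card ({..<n} - X)) / real n \<le> \<epsilon> / 2"
          using N[of n] that by (simp add: field_simps)
        then have "real (card ({..<n} - X)) / real n < \<epsilon>"
          using \<open>\<epsilon> > 0\<close> by linarith
        then show ?thesis using dist[of n] that by linarith
      qed
      then show "\<exists>N. \<forall>n\<ge>N. dist (real (card (X \<inter> {..<n})) / real n) 1 < \<epsilon>" by blast
    qed
  qed
qed

lemma density_one_Int:
  assumes "density_one X" "density_one Y"
  shows "density_one (X \<inter> Y)"
  unfolding density_one_iff
proof (intro allI impI)
  fix \<epsilon> :: real assume "\<epsilon> > 0"
  then obtain N M where NM: "\<And>n. n \<ge> N \<Longrightarrow> real (card ({..<n} - X)) \<le> \<epsilon> / 2 * real n"
    "\<And>n. n \<ge> M \<Longrightarrow> real (card ({..<n} - Y)) \<le> \<epsilon> / 2 * real n"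
    using assms unfolding density_one_iff by (meson half_gt_zero)
  have "real (card ({..<n} - X \<inter> Y)) \<le> \<epsilon> * real n" if "n \<ge> max N M" for n
  proof -
    have "card ({..<n} - X \<inter> Y) \<le> card ({..<n} - X) + card ({..<n} - Y)"
      by (simp add: Diff_Int card_Un_le)
    then have "real (card ({..<n} - X \<inter> Y)) \<le> real (card ({..<n} - X)) + real (card ({..<n} - Y))"
      by linarith
    then show ?thesis using NM(1)[of n] NM(2)[of n] that by auto
  qed
  then show "\<exists>N. \<forall>n\<ge>N. real (card ({..<n} - X \<inter> Y)) \<le> \<epsilon> * real n" by blast
qed

section \<open>Rows and blocks\<close>

text \<open>
  The first disjunct puts 0 into row 0; the definition of \<open>blk\<close> puts it into block 0.
\<close>

definition row :: "nat \<Rightarrow> nat" where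
  "row m = (LEAST e. m = 0 \<or> \<not> 2 ^ Suc e dvd m)"

definition blk :: "nat \<Rightarrow> nat" where
  "blk m = (LEAST n. m < 2 ^ Suc n)"

lemma ex_row: "\<exists>e. m = 0 \<or> \<not> 2 ^ Suc e dvd (m :: nat)"
proof (cases "m = 0")
  case False
  have "m < 2 ^ Suc m" by (rule less_trans[OF less_exp]) simp
  then have "\<not> 2 ^ Suc m dvd m" using False dvd_imp_le not_le by blast
  then show ?thesis by blast
qed simp

lemma ex_blk: "\<exists>n. (m :: nat) < 2 ^ Suc n"
  by (rule exI, rule less_trans[OF less_exp[of m]]) (rule power_strict_increasing[OF lessI], simp)

lemma recfun_row [recfun_intros]: "recfun f \<Longrightarrow> recfun (\<lambda>x. row (f x))"
proof (rule recfun_comp[of row])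
  have "recfun (\<lambda>m :: nat. LEAST e. m = 0 \<or> \<not> m mod 2 ^ Suc e = 0)"
    using ex_row unfolding dvd_eq_mod_eq_0 by (intro recfun_Least recfun_intros)
  then show "recfun row"
    by (simp add: row_def[abs_def] dvd_eq_mod_eq_0)
qed

lemma recfun_blk [recfun_intros]: "recfun f \<Longrightarrow> recfun (\<lambda>x. blk (f x))"
  unfolding blk_def
  by (rule recfun_comp[OF recfun_Least[OF _ ex_blk]]) (intro recfun_intros)

lemma power_dvd_of_row: "k \<le> row m \<Longrightarrow> 2 ^ k dvd m"
  using not_less_Least[of "k - 1" "\<lambda>e. m = 0 \<or> \<not> 2 ^ Suc e dvd m"]
  by (cases k) (auto simp: row_def)

lemma row_eqI: "row (2 ^ e * Suc (2 * j)) = e"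
  unfolding row_def
proof (rule Least_equality)
  show "2 ^ e * Suc (2 * j) = 0 \<or> \<not> 2 ^ Suc e dvd 2 ^ e * Suc (2 * j)"
    by (simp del: mult_Suc_right add: mult.commute[of 2])
next
  fix k assume *: "2 ^ e * Suc (2 * j) = 0 \<or> \<not> 2 ^ Suc k dvd 2 ^ e * Suc (2 * j)"
  show "e \<le> k"
  proof (rule ccontr)
    assume "\<not> e \<le> k"
    then have "2 ^ Suc k dvd (2 :: nat) ^ e" by (intro le_imp_power_dvd) simp
    then show False using * by (simp del: mult_Suc_right power_Suc)
  qed
qed

lemma less_power_blk: "m < 2 ^ Suc (blk m)"
  unfolding blk_def using ex_blk by (rule LeastI_ex)

lemma blk_eqI:
  assumes "2 ^ n \<le> m" "m < 2 ^ Suc n"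
  shows "blk m = n"
  unfolding blk_def
proof (rule Least_equality)
  fix k assume "m < 2 ^ Suc k"
  then have "(2::nat) ^ n < 2 ^ Suc k" using assms(1) by linarith
  then have "n < Suc k" by (rule power_less_imp_less_exp[rotated]) simp
  then show "n \<le> k" by simp
qed (fact assms(2))

lemma power_blk_le: "0 < m \<Longrightarrow> 2 ^ blk m \<le> m"
  using not_less_Least[of "blk m - 1" "\<lambda>n. m < 2 ^ Suc n"]
  by (cases "blk m") (auto simp: blk_def)

lemma blk_le: "blk m \<le> m"
proof (cases "m = 0")
  case True
  then show ?thesis by (simp add: blk_def)
next
  case False
  then show ?thesis using power_blk_le[of m] less_exp[of "blk m"] by linarith
qed

text \<open>Row \<open>e\<close> has \<open>2 ^ (n - Suc e)\<close> elements in a late block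
  \<open>n\<close>, a fraction \<open>1 / 2 ^ (e + 2)\<close> of the numbers below
  \<open>2 ^ Suc n\<close>. Missing all of them exceeds the tolerance
  \<open>1 / 2 ^ (e + 3)\<close>.\<close>

lemma density_one_meets_block:
  assumes "density_one W"
  shows "\<exists>n0. \<forall>n\<ge>n0. \<exists>m\<in>W. 0 < m \<and> row m = e \<and> blk m = n"
proof -
  obtain N where N: "\<And>n. n \<ge> N \<Longrightarrow> real (card ({..<n} - W)) \<le> 1 / 2 ^ (e + 3) * real n"
    using assms unfolding density_one_iff by (meson zero_less_divide_1_iff zero_less_numeral zero_less_power)
  have "\<exists>m\<in>W. 0 < m \<and> row m = e \<and> blk m = n" if n: "n \<ge> N + Suc e" for n
  proof (rule ccontr)
    assume none: "\<not> ?thesis"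
    define k where "k = n - Suc e"
    have nk: "n = k + Suc e" using n by (simp add: k_def)
    \<comment> \<open>These are the odd multiples of \<open>2 ^ e\<close> in block
      \<open>n\<close>.\<close>
    define S where "S = (\<lambda>j. 2 ^ e * Suc (2 * j)) ` {2 ^ k..<2 ^ Suc k}"
    have "card S = 2 ^ k"
      unfolding S_def by (subst card_image) (auto simp: inj_on_def)
    have *: "2 ^ n \<le> s \<and> s < 2 ^ Suc n \<and> row s = e" if s: "s \<in> S" for s
    proof -
      obtain j where j: "s = 2 ^ e * Suc (2 * j)" "2 ^ k \<le> j" "j < 2 ^ Suc k"
        using s unfolding S_def by auto
      have "(2::nat) ^ n = 2 ^ e * (2 * 2 ^ k)" "(2::nat) ^ Suc n = 2 ^ e * (2 * 2 ^ Suc k)"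
        by (simp_all add: nk power_add)
      then show ?thesis
        using j row_eqI by (simp del: power_Suc mult_Suc_right)
    qed
    have "S \<inter> W = {}"
    proof -
      have "s \<notin> W" if "s \<in> S" for s
        using *[OF that] none blk_eqI[of n s] by (metis less_le_trans zero_less_numeral zero_less_power)
      then show ?thesis by blast
    qed
    then have "S \<subseteq> {..<2 ^ Suc n} - W" using * by auto
    then have "2 ^ k \<le> card ({..<2 ^ Suc n} - W)"
      using card_mono[of "{..<2 ^ Suc n} - W" S] \<open>card S = 2 ^ k\<close> by auto
    then have "(2::real) ^ k \<le> real (card ({..<2 ^ Suc n} - W))"
      by (metis of_nat_le_iff of_nat_numeral of_nat_power)
    also have "\<dots> \<le> 1 / 2 ^ (e + 3) * real (2 ^ Suc n)"
      using n less_exp[of "Suc n"] by (intro N) linarith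
    also have "\<dots> = 2 ^ k / 2"
      by (simp add: nk power_add field_simps)
    finally show False by simp
  qed
  then show ?thesis by blast
qed

lemma card_multiples_le: "card {m \<in> {..<n}. d dvd m} \<le> Suc (n div d)" if "d > 0" for d n :: nat
proof -
  have "{m \<in> {..<n}. d dvd m} \<subseteq> (\<lambda>j. d * j) ` {..n div d}"
    using that by (auto elim!: dvdE simp: image_iff div_le_mono less_eq_div_iff_mult_less_eq mult.commute)
  then have "card {m \<in> {..<n}. d dvd m} \<le> card ((\<lambda>j. d * j) ` {..n div d})"
    by (intro card_mono) auto
  also have "\<dots> \<le> Suc (n div d)"
    using card_image_le[of "{..n div d}" "\<lambda>j. d * j"] by simp
  finally show ?thesis .
qed

text \<open>Rows from \<open>k\<close> on consist of multiples of \<open>2 ^ k\<close>, apart from 0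
  a small fraction of all numbers. Each of the finitely many rows below \<open>k\<close> omits only
  elements of early blocks, all of them below a constant \<open>M\<close>.\<close>

lemma density_oneI_rows:
  assumes "\<And>e. \<exists>N. \<forall>m. row m = e \<and> N \<le> blk m \<longrightarrow> m \<in> B"
  shows "density_one B"
  unfolding density_one_iff
proof (intro allI impI)
  fix \<epsilon> :: real assume \<epsilon>: "\<epsilon> > 0"
  then obtain k where k: "(1 / 2) ^ k < \<epsilon> / 2"
    using real_arch_pow_inv[of "\<epsilon> / 2" "1 / 2"] by auto
  obtain N where N: "\<And>e m. row m = e \<Longrightarrow> N e \<le> blk m \<Longrightarrow> m \<in> B"
    using assms by metis
  define M where "M = (2::nat) ^ Suc (Max (N ` {..k}))"
  have "real (card ({..<n} - B)) \<le> \<epsilon> * real n" if n: "n \<ge> nat \<lceil>(real M + 1) / (\<epsilon> / 2)\<rceil>" for n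
  proof -
    have "{..<n} - B \<subseteq> {..<M} \<union> {m \<in> {..<n}. 2 ^ k dvd m}"
    proof
      fix m assume m: "m \<in> {..<n} - B"
      show "m \<in> {..<M} \<union> {m \<in> {..<n}. 2 ^ k dvd m}"
      proof (cases "k \<le> row m")
        case True
        then show ?thesis using m power_dvd_of_row by auto
      next
        case False
        then have "N (row m) \<le> Max (N ` {..k})" by (intro Max_ge) auto
        moreover have "blk m < N (row m)" using N[of m] m by (meson DiffD2 not_le)
        ultimately have "(2::nat) ^ Suc (blk m) \<le> M"
          unfolding M_def by (intro power_increasing) auto
        then show ?thesis using less_power_blk[of m] by auto
      qed
    qed
    then have "card ({..<n} - B) \<le> card ({..<M} \<union> {m \<in> {..<n}. 2 ^ k dvd m})"
      by (intro card_mono) auto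
    also have "\<dots> \<le> M + Suc (n div 2 ^ k)"
      using card_Un_le[of "{..<M}" "{m \<in> {..<n}. 2 ^ k dvd m}"] card_multiples_le[of "2 ^ k" n]
      by simp
    finally have "real (card ({..<n} - B)) \<le> real M + 1 + real (n div 2 ^ k)"
      by linarith
    moreover have "real (n div 2 ^ k) \<le> real n * (1 / 2) ^ k"
    proof -
      have "real (n div 2 ^ k * 2 ^ k) \<le> real n"
        by (intro of_nat_mono div_times_less_eq_dividend)
      then show ?thesis by (simp add: power_one_over field_simps)
    qed
    moreover have "real n * (1 / 2) ^ k \<le> real n * (\<epsilon> / 2)"
      using k by (intro mult_left_mono) auto
    moreover have "real M + 1 \<le> real n * (\<epsilon> / 2)"
      using n \<epsilon> by (simp add: field_simps nat_ceiling_le_eq)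
    ultimately have "real (card ({..<n} - B)) \<le> real n * (\<epsilon> / 2) + real n * (\<epsilon> / 2)"
      by linarith
    then show ?thesis by (simp add: mult.commute)
  qed
  then show "\<exists>N. \<forall>n\<ge>N. real (card ({..<n} - B)) \<le> \<epsilon> * real n" by blast
qed

section \<open>The strategy on one row\<close>

definition touched :: "nat \<Rightarrow> nat \<Rightarrow> nat \<Rightarrow> bool" where
  "touched e n s \<longleftrightarrow> (\<exists>m<s. row m = e \<and> blk m = n \<and> enumerated e m s)"

text \<open>
  \<open>expands e k n\<close> holds for infinitely many \<open>n\<close> if and only if all blocks from \<open>k\<close> on are touched
  eventually; so \<open>lev e n\<close> tends to infinity unless almost all blocks are touched.
\<close>

definition expands :: "nat \<Rightarrow> nat \<Rightarrow> nat \<Rightarrow> bool" where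
  "expands e k n \<longleftrightarrow> (\<exists>m<n. k \<le> m \<and> (\<forall>i<m. k \<le> i \<longrightarrow> touched e i (n - 1)) \<and>
     \<not> touched e m (n - 1) \<and> touched e m n)"

definition lev :: "nat \<Rightarrow> nat \<Rightarrow> nat" where
  "lev e n = (LEAST k. k = n \<or> expands e k n)"

definition agree :: "nat \<Rightarrow> nat set \<Rightarrow> nat set \<Rightarrow> bool" where
  "agree l X Y \<longleftrightarrow> (\<forall>i<l. i \<in> X \<longleftrightarrow> i \<in> Y)"

lemma touched_mono: "touched e n s \<Longrightarrow> s \<le> s' \<Longrightarrow> touched e n s'"
  unfolding touched_def by (blast intro: enumerated_mono less_le_trans)

lemma lev_le: "lev e n \<le> n"
  unfolding lev_def by (rule Least_le) simp

lemma lev_le_expands: "expands e k n \<Longrightarrow> lev e n \<le> k"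
  unfolding lev_def by (rule Least_le) simp

lemma expands_lev: "lev e n \<noteq> n \<Longrightarrow> expands e (lev e n) n"
  using LeastI_ex[of "\<lambda>k. k = n \<or> expands e k n"] unfolding lev_def by auto

text \<open>Let \<open>m\<close> be the first block from \<open>k\<close> on that is untouched at
  stage \<open>N\<close>. The stage at which \<open>m\<close> is first touched is the required
  \<open>n\<close>.\<close>

lemma expands_infinitely_often:
  assumes "\<And>n. k \<le> n \<Longrightarrow> \<exists>s. touched e n s"
  shows "\<exists>n\<ge>N. expands e k n"
proof -
  have "finite {m. touched e m N}"
    by (rule finite_subset[of _ "{..N}"]) (auto simp: touched_def intro: less_imp_le le_less_trans[OF blk_le])
  then have "\<exists>m\<ge>k. \<not> touched e m N"
    by (metis (mono_tags, lifting) finite_nat_set_iff_bounded_le mem_Collect_eq nat_le_linear not_less_eq_eq)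
  then obtain m where m: "k \<le> m" "\<not> touched e m N" and least: "\<And>i. k \<le> i \<Longrightarrow> i < m \<Longrightarrow> touched e i N"
    using exists_least_iff[of "\<lambda>m. k \<le> m \<and> \<not> touched e m N"] by blast
  define n where "n = (LEAST s. touched e m s)"
  have n: "touched e m n"
    unfolding n_def using assms[OF m(1)] by (rule LeastI_ex)
  have "N < n"
    using n m(2) touched_mono by (meson not_le)
  moreover have "\<not> touched e m (n - 1)"
    using \<open>N < n\<close> not_less_Least[of "n - 1" "touched e m"] by (simp add: n_def)
  moreover have "touched e i (n - 1)" if "k \<le> i" "i < m" for i
    using least[OF that] \<open>N < n\<close> by (auto intro: touched_mono)
  moreover have "m < n"
    using n blk_le le_less_trans unfolding touched_def by blast
  ultimately have "expands e k n"
    unfolding expands_def using m(1) n by blast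
  then show ?thesis using \<open>N < n\<close> by (meson less_imp_le)
qed

text \<open>The block that witnesses \<open>expands e k n\<close> precedes \<open>m0\<close> and
  determines \<open>n\<close> as the first stage at which it is touched.\<close>

lemma expands_finitely_often:
  assumes "k \<le> m0" "\<And>s. \<not> touched e m0 s"
  shows "finite {n. expands e k n}"
proof (rule finite_subset)
  show "{n. expands e k n} \<subseteq> (\<lambda>m. LEAST s. touched e m s) ` {..<m0}"
  proof
    fix n assume "n \<in> {n. expands e k n}"
    then obtain m where m: "k \<le> m" "\<forall>i<m. k \<le> i \<longrightarrow> touched e i (n - 1)"
      "\<not> touched e m (n - 1)" "touched e m n"
      unfolding expands_def by blast
    have "m < m0"
      using assms m by (metis linorder_neqE_nat)
    moreover have "n = (LEAST s. touched e m s)"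
    proof (rule Least_equality[symmetric])
      fix s assume "touched e m s"
      then show "n \<le> s"
        using m(3) touched_mono[of e m s "n - 1"] by linarith
    qed (fact m(4))
    ultimately show "n \<in> (\<lambda>m. LEAST s. touched e m s) ` {..<m0}" by blast
  qed
qed simp

lemma lev_tendsto_infinity:
  assumes "\<And>k. \<exists>m\<ge>k. \<forall>s. \<not> touched e m s"
  shows "\<exists>N. \<forall>n\<ge>N. k < lev e n"
proof -
  have "finite (\<Union>k'\<le>k. {n. expands e k' n})"
    using assms expands_finitely_often by (intro finite_UN_I) blast+
  then obtain N where N: "\<And>n k'. k' \<le> k \<Longrightarrow> expands e k' n \<Longrightarrow> n < N"
    unfolding finite_nat_set_iff_bounded by blast
  have "k < lev e n" if "n \<ge> max N (Suc k)" for n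
  proof (rule ccontr)
    assume *: "\<not> k < lev e n"
    then have "expands e (lev e n) n"
      using that by (intro expands_lev) linarith
    then have "n < N" using N[of "lev e n" n] * by linarith
    then show False using that by simp
  qed
  then show ?thesis by blast
qed

lemma recfun_touched [recfun_intros]:
  assumes "recfun e" "recfun n" "recfun s"
  shows "recfun (\<lambda>x. touched (e x) (n x) (s x))"
  unfolding touched_def
  by (intro recfun_intros assms assms[THEN recfun_comp])

lemma recfun_lev [recfun_intros]:
  assumes "recfun e" "recfun n"
  shows "recfun (\<lambda>x. lev (e x) (n x))"
  unfolding lev_def expands_def
  by (intro recfun_Least recfun_intros assms assms[THEN recfun_comp]) auto

section \<open>Strings as binary numbers\<close>

text \<open>This is \<open>agree\<close> for binary expansions, in a form accessible to the closure
  rules.\<close>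

definition matches :: "nat \<Rightarrow> nat \<Rightarrow> nat \<Rightarrow> bool" where
  "matches l y z \<longleftrightarrow> (\<forall>i<l. even (y div 2 ^ i) \<longleftrightarrow> even (z div 2 ^ i))"

lemma matches_iff: "matches l y z \<longleftrightarrow> agree l (set_decode y) (set_decode z)"
  unfolding matches_def agree_def set_decode_def by auto

lemma recfun_matches [recfun_intros]:
  assumes "recfun l" "recfun y" "recfun z"
  shows "recfun (\<lambda>x. matches (l x) (y x) (z x))"
  unfolding matches_def
  by (intro recfun_intros assms assms[THEN recfun_comp])

lemma set_encode_less: "X \<subseteq> {..<k} \<Longrightarrow> set_encode X < 2 ^ k"
proof -
  assume "X \<subseteq> {..<k}"
  then have "set_encode X \<le> (\<Sum>i<k. 2 ^ i)"
    unfolding set_encode_def by (intro sum_mono2) auto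
  also have "\<dots> < 2 ^ k"
    by (induction k) auto
  finally show ?thesis .
qed

lemma agree_sym: "agree l X Y \<Longrightarrow> agree l Y X"
  by (auto simp: agree_def)

lemma agree_trans: "agree l X Y \<Longrightarrow> agree l Y Z \<Longrightarrow> agree l X Z"
  by (auto simp: agree_def)

lemma agree_antimono: "agree l X Y \<Longrightarrow> k \<le> l \<Longrightarrow> agree k X Y"
  by (auto simp: agree_def)

section \<open>Choice of the strings\<close>

text \<open>
  A string is coded by the number with these binary digits, and a history is a list of blocks
  with their strings. Bit \<open>i\<close> of the string of block \<open>n\<close> is the opposite of \<open>a i n\<close> whenever
  some real outside the strings of touched blocks extends the result.
\<close>

locale strategy =
  fixes a :: "nat \<Rightarrow> nat \<Rightarrow> bool" and b :: "nat \<Rightarrow> bool"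
  assumes rec_a: "recfun (\<lambda>z. a (fst z) (snd z))"
    and lim_a: "\<exists>N. \<forall>n\<ge>N. a i n = b i"
begin

text \<open>The history is a parameter because the strings are still being built by recursion;
  \<open>covered\<close> is the same notion for reals, stated with the finished strings.\<close>

definition covers :: "nat \<Rightarrow> nat \<Rightarrow> (nat \<times> nat) list \<Rightarrow> nat \<Rightarrow> bool" where
  "covers e n h y \<longleftrightarrow> (\<exists>g\<in>set h. touched e (fst g) n \<and> matches (lev e (fst g)) y (snd g))"

definition alive :: "nat \<Rightarrow> nat \<Rightarrow> (nat \<times> nat) list \<Rightarrow> nat \<Rightarrow> nat \<Rightarrow> bool" where
  "alive e n h i z \<longleftrightarrow> (\<exists>y<2 ^ (n + i). matches i y z \<and> \<not> covers e n h y)"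

definition greedy :: "nat \<Rightarrow> nat \<Rightarrow> (nat \<times> nat) list \<Rightarrow> nat \<Rightarrow> nat" where
  "greedy e n h = rec_nat 0 (\<lambda>i z.
     if a i n then (if alive e n h (Suc i) z then z else 2 ^ i + z)
     else (if alive e n h (Suc i) (2 ^ i + z) then 2 ^ i + z else z))"

definition history :: "nat \<Rightarrow> nat \<Rightarrow> (nat \<times> nat) list" where
  "history e = rec_nat [] (\<lambda>m h. (m, greedy e m h (lev e m)) # h)"

text \<open>Prefixes of every length \<open>i\<close> are considered; the string of block
  \<open>n\<close> is \<open>guess e n (lev e n)\<close>.\<close>

definition guess :: "nat \<Rightarrow> nat \<Rightarrow> nat \<Rightarrow> nat set" where
  "guess e n i = set_decode (greedy e n (history e n) i)"

definition covered :: "nat \<Rightarrow> nat \<Rightarrow> nat set \<Rightarrow> bool" where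
  "covered e n Y \<longleftrightarrow> (\<exists>m<n. touched e m n \<and> agree (lev e m) Y (guess e m (lev e m)))"

text \<open>In particular, \<open>live e n 0 {}\<close> says that some real is still uncovered at
  stage \<open>n\<close>.\<close>

definition live :: "nat \<Rightarrow> nat \<Rightarrow> nat \<Rightarrow> nat set \<Rightarrow> bool" where
  "live e n i S \<longleftrightarrow> (\<exists>Y. agree i Y S \<and> \<not> covered e n Y)"

lemma recfun_alive [recfun_intros]:
  assumes "recfun e" "recfun n" "recfun h" "recfun i" "recfun z"
  shows "recfun (\<lambda>x. alive (e x) (n x) (h x) (i x) (z x))"
  unfolding alive_def covers_def by (intro recfun_intros assms assms[THEN recfun_comp])

lemma recfun_a [recfun_intros]: "recfun f \<Longrightarrow> recfun g \<Longrightarrow> recfun (\<lambda>x. a (f x) (g x))"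
  by (rule recfun_comp2[OF rec_a])

lemma recfun_greedy [recfun_intros]:
  assumes "recfun e" "recfun n" "recfun h" "recfun i"
  shows "recfun (\<lambda>x. greedy (e x) (n x) (h x) (i x))"
  unfolding greedy_def
  by (intro recfun_intros assms assms[THEN recfun_comp])

lemma recfun_history [recfun_intros]:
  assumes "recfun e" "recfun n"
  shows "recfun (\<lambda>x. history (e x) (n x))"
  unfolding history_def
  by (intro recfun_intros assms assms[THEN recfun_comp])

lemma recfun_member_guess [recfun_intros]:
  assumes "recfun e" "recfun n" "recfun i" "recfun j"
  shows "recfun (\<lambda>x. j x \<in> guess (e x) (n x) (i x))"
  unfolding guess_def set_decode_def mem_Collect_eq
  by (intro recfun_intros assms)

lemma set_history: "set (history e n) = (\<lambda>m. (m, greedy e m (history e m) (lev e m))) ` {..<n}"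
proof (induction n)
  case (Suc n)
  have "history e (Suc n) = (n, greedy e n (history e n) (lev e n)) # history e n"
    by (simp add: history_def)
  then show ?case by (simp add: Suc lessThan_Suc)
qed (simp add: history_def)

lemma covers_iff: "covers e n (history e n) y \<longleftrightarrow> covered e n (set_decode y)"
  unfolding covers_def covered_def set_history matches_iff guess_def by auto

text \<open>Only bits below \<open>n\<close> matter, because \<open>lev e m \<le> m\<close> for each
  block \<open>m < n\<close>.\<close>

lemma covered_cong:
  assumes "agree n X Y"
  shows "covered e n X \<longleftrightarrow> covered e n Y"
proof -
  have "agree (lev e m) X Z \<longleftrightarrow> agree (lev e m) Y Z" if "m < n" for m Z
    using assms lev_le[of e m] that unfolding agree_def by (meson le_less_trans less_trans)
  then show ?thesis unfolding covered_def by blast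
qed

text \<open>An uncovered real may be truncated to \<open>n + i\<close> bits: coverage depends on the
  bits below \<open>n\<close>, agreement on those below \<open>i\<close>.\<close>

lemma alive_iff: "alive e n (history e n) i z \<longleftrightarrow> live e n i (set_decode z)"
proof
  assume "live e n i (set_decode z)"
  then obtain Y where Y: "agree i Y (set_decode z)" "\<not> covered e n Y"
    unfolding live_def by blast
  define y where "y = set_encode (Y \<inter> {..<n + i})"
  have y: "set_decode y = Y \<inter> {..<n + i}" "y < 2 ^ (n + i)"
    by (simp_all add: y_def set_encode_less)
  have "agree i (set_decode y) Y" "agree n (set_decode y) Y"
    by (auto simp: y agree_def)
  then have "agree i (set_decode y) (set_decode z)" "\<not> covered e n (set_decode y)"
    using Y agree_trans covered_cong by blast+
  then show "alive e n (history e n) i z"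
    unfolding alive_def matches_iff covers_iff using y(2) by blast
qed (auto simp: alive_def live_def matches_iff covers_iff)

lemma guess_0 [simp]: "guess e n 0 = {}"
  by (simp add: guess_def greedy_def)

text \<open>Adding \<open>2 ^ i\<close> sets bit \<open>i\<close> only if that bit is 0, so the
  recursion equation rests on the inclusion, which is in turn proved by this recursion.\<close>

lemma guess_subset: "guess e n i \<subseteq> {..<i}"
  and guess_Suc: "guess e n (Suc i) =
    (if a i n then (if live e n (Suc i) (guess e n i) then guess e n i else insert i (guess e n i))
     else (if live e n (Suc i) (insert i (guess e n i)) then insert i (guess e n i)
       else guess e n i))"
proof -
  have Suc: "guess e n (Suc i) =
    (if a i n then (if live e n (Suc i) (guess e n i) then guess e n i else insert i (guess e n i))
     else (if live e n (Suc i) (insert i (guess e n i)) then insert i (guess e n i)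
       else guess e n i))" if "guess e n i \<subseteq> {..<i}" for i
  proof -
    have "i \<notin> set_decode (greedy e n (history e n) i)"
      using that unfolding guess_def by auto
    from set_decode_plus_power_2[OF this]
    have "set_decode (2 ^ i + greedy e n (history e n) i) = insert i (guess e n i)"
      by (simp add: guess_def)
    then show ?thesis
      unfolding guess_def greedy_def by (simp add: alive_iff)
  qed
  show sub: "guess e n i \<subseteq> {..<i}" for i
    by (induction i) (auto simp: Suc split: if_splits)
  show "guess e n (Suc i) =
    (if a i n then (if live e n (Suc i) (guess e n i) then guess e n i else insert i (guess e n i))
     else (if live e n (Suc i) (insert i (guess e n i)) then insert i (guess e n i)
       else guess e n i))"
    by (rule Suc[OF sub])
qed

lemma agree_guess: "j \<le> i \<Longrightarrow> agree j (guess e n i) (guess e n j)"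
proof (induction i rule: dec_induct)
  case (step i)
  have "agree i (guess e n (Suc i)) (guess e n i)"
    unfolding guess_Suc agree_def by auto
  then show ?case using step by (meson agree_antimono agree_trans)
qed (simp add: agree_def)

lemma covered_mono: "covered e n Y \<Longrightarrow> n \<le> n' \<Longrightarrow> covered e n' Y"
  unfolding covered_def by (meson order_less_le_trans touched_mono)

lemma live_antimono: "live e n' i S \<Longrightarrow> n \<le> n' \<Longrightarrow> live e n i S"
  unfolding live_def using covered_mono by blast

lemma live_cong: "agree i S T \<Longrightarrow> live e n i S \<longleftrightarrow> live e n i T"
  unfolding live_def by (meson agree_sym agree_trans)

lemma live_shorter: "live e n i S \<Longrightarrow> k \<le> i \<Longrightarrow> live e n k S"
  unfolding live_def by (meson agree_antimono)

lemma live_Suc: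
  assumes "live e n i S" "S \<subseteq> {..<i}"
  shows "live e n (Suc i) S \<or> live e n (Suc i) (insert i S)"
proof -
  obtain Y where Y: "agree i Y S" "\<not> covered e n Y"
    using assms(1) unfolding live_def by blast
  have "agree (Suc i) Y S \<or> agree (Suc i) Y (insert i S)"
    using Y(1) assms(2) unfolding agree_def by (auto simp: less_Suc_eq)
  then show ?thesis using Y(2) unfolding live_def by blast
qed

text \<open>By \<open>live_Suc\<close> a live string has a live extension, and the preferred
  extension is taken only if it is live.\<close>

lemma live_guess: "live e n 0 {} \<Longrightarrow> live e n i (guess e n i)"
proof (induction i)
  case (Suc i)
  then show ?case
    using live_Suc[of e n i "guess e n i"] guess_subset by (auto simp: guess_Suc)
qed simp

section \<open>The limit of the strings\<close>

definition outcome :: "nat \<Rightarrow> nat set" where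
  "outcome e = {i. \<exists>N. \<forall>n\<ge>N. i \<in> guess e n (Suc i)}"

text \<open>Once the first \<open>i\<close> bits are stable, the next one depends only on
  \<open>a i n\<close> and on the liveness of two fixed strings, and these are eventually
  constant.\<close>

lemma guess_tendsto: "\<exists>N. \<forall>n\<ge>N. guess e n i = outcome e \<inter> {..<i}"
proof (induction i)
  case (Suc i)
  let ?S = "outcome e \<inter> {..<i}"
  obtain N where N: "\<And>n. n \<ge> N \<Longrightarrow> guess e n i = ?S"
    using Suc by blast
  obtain M where M: "\<And>n. n \<ge> M \<Longrightarrow> a i n = b i"
    using lim_a by blast
  \<comment> \<open>Liveness can only be lost as \<open>n\<close> grows, hence it changes at most
    once.\<close>
  have "\<exists>L. \<forall>n\<ge>L. live e n (Suc i) T \<longleftrightarrow> live e L (Suc i) T" for T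
    using live_antimono by (cases "\<forall>n. live e n (Suc i) T") blast+
  then obtain K L where KL: "\<And>n. n \<ge> K \<Longrightarrow> live e n (Suc i) ?S \<longleftrightarrow> live e K (Suc i) ?S"
    "\<And>n. n \<ge> L \<Longrightarrow> live e n (Suc i) (insert i ?S) \<longleftrightarrow> live e L (Suc i) (insert i ?S)"
    by metis
  define R where "R = max (max N M) (max K L)"
  have const: "guess e n (Suc i) = guess e R (Suc i)" if "n \<ge> R" for n
  proof -
    have le: "N \<le> R" "M \<le> R" "K \<le> R" "L \<le> R" "N \<le> n" "M \<le> n" "K \<le> n" "L \<le> n"
      using that by (simp_all add: R_def)
    have S: "guess e R i = ?S" "guess e n i = ?S"
      by (rule N[OF le(1)], rule N[OF le(5)])
    moreover have "a i n = a i R"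
      by (rule trans[OF M[OF le(6)] M[OF le(2), symmetric]])
    moreover have "live e n (Suc i) ?S = live e R (Suc i) ?S"
      by (rule trans[OF KL(1)[OF le(7)] KL(1)[OF le(3), symmetric]])
    moreover have "live e n (Suc i) (insert i ?S) = live e R (Suc i) (insert i ?S)"
      by (rule trans[OF KL(2)[OF le(8)] KL(2)[OF le(4), symmetric]])
    ultimately show ?thesis unfolding guess_Suc by simp
  qed
  have "i \<in> outcome e \<longleftrightarrow> i \<in> guess e R (Suc i)"
    unfolding outcome_def mem_Collect_eq using const by (metis nle_le)
  moreover have "x \<in> outcome e \<longleftrightarrow> x \<in> guess e R (Suc i)" if "x < i" for x
    using agree_guess[of i "Suc i" e R] N[of R] that by (auto simp: agree_def R_def)
  moreover have "x < Suc i" if "x \<in> guess e R (Suc i)" for x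
    using guess_subset that by blast
  ultimately have "x \<in> guess e R (Suc i) \<longleftrightarrow> x \<in> outcome e \<inter> {..<Suc i}" for x
    by (metis IntD1 IntD2 IntI lessThan_iff less_SucE)
  then have "guess e R (Suc i) = outcome e \<inter> {..<Suc i}" by blast
  then show ?case using const by metis
qed simp

lemma live_outcome:
  assumes "\<And>n. live e n 0 {}"
  shows "live e n i (outcome e)"
proof -
  obtain N where "\<And>n. n \<ge> N \<Longrightarrow> guess e n i = outcome e \<inter> {..<i}"
    using guess_tendsto by blast
  then have "agree i (guess e (max n N) i) (outcome e)"
    by (auto simp: agree_def)
  then have "live e (max n N) i (outcome e)"
    using live_guess[OF assms] live_cong by blast
  then show ?thesis by (rule live_antimono) simp
qed

text \<open>A string covering the outcome covers all reals with the same initial segment, against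
  the liveness of that segment.\<close>

lemma outcome_not_covered:
  assumes "\<And>n. live e n 0 {}"
  shows "\<not> covered e n (outcome e)"
proof
  assume "covered e n (outcome e)"
  then obtain m where m: "m < n" "touched e m n" "agree (lev e m) (outcome e) (guess e m (lev e m))"
    unfolding covered_def by blast
  obtain Y where "agree (lev e m) Y (outcome e)" "\<not> covered e n Y"
    using live_outcome[OF assms] unfolding live_def by blast
  then show False
    using m agree_trans unfolding covered_def by blast
qed

text \<open>Infinitely many blocks have strings of length at most \<open>n0\<close>. Late ones among
  these strings are initial segments of the outcome, and as their blocks are touched, they cover
  it.\<close>

lemma dead_if_all_touched:
  assumes "\<And>n. n \<ge> n0 \<Longrightarrow> \<exists>s. touched e n s"
  shows "\<exists>n. \<not> live e n 0 {}"
proof (rule ccontr)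
  assume "\<nexists>n. \<not> live e n 0 {}"
  then have live: "\<And>n. live e n 0 {}" by blast
  obtain N where N: "\<And>n. n \<ge> N \<Longrightarrow> guess e n n0 = outcome e \<inter> {..<n0}"
    using guess_tendsto by blast
  obtain n where n: "n \<ge> max N n0" "expands e n0 n"
    using expands_infinitely_often[OF assms] by blast
  have le: "lev e n \<le> n0" by (rule lev_le_expands[OF n(2)])
  have "agree n0 (outcome e) (guess e n n0)"
    using N n(1) by (auto simp: agree_def)
  then have "agree (lev e n) (outcome e) (guess e n (lev e n))"
    using agree_guess[OF le] agree_antimono[OF _ le] agree_trans by blast
  moreover obtain s where "touched e n s" using assms n(1) by (meson max.boundedE)
  ultimately have "covered e (max s (Suc n)) (outcome e)"
    unfolding covered_def by (intro exI[of _ n]) (auto intro: touched_mono)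
  then show False using outcome_not_covered[OF live] by blast
qed

section \<open>Removed blocks\<close>

text \<open>The first conjunct stops all removals once every real is covered, that is, once the row
  has succeeded.\<close>

definition removed :: "nat set \<Rightarrow> nat \<Rightarrow> nat \<Rightarrow> bool" where
  "removed X e n \<longleftrightarrow> live e n 0 {} \<and> agree (lev e n) X (guess e n (lev e n))"

text \<open>At the first stage at which all reals are covered, some earlier touched block covers
  \<open>X\<close>; its own stage was still live, so it is removed.\<close>

lemma removed_if_all_touched:
  assumes "\<And>n. n \<ge> n0 \<Longrightarrow> \<exists>s. touched e n s"
  shows "\<exists>m s. row m = e \<and> enumerated e m s \<and> removed X e (blk m)"
proof -
  obtain n where n: "\<not> live e n 0 {}" and least: "\<And>m. m < n \<Longrightarrow> live e m 0 {}"
    using dead_if_all_touched[OF assms] exists_least_iff[of "\<lambda>n. \<not> live e n 0 {}"] by blast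
  have "covered e n X"
    using n unfolding live_def agree_def by blast
  then obtain m where "m < n" "touched e m n" "agree (lev e m) X (guess e m (lev e m))"
    unfolding covered_def by blast
  then show ?thesis
    using least unfolding removed_def touched_def by blast
qed

text \<open>
  If the outcome agrees with \<open>b\<close> from some position on, then each of its later bits is found by
  waiting until the opposite bit is dead.
\<close>

lemma opposite_dies:
  assumes "i \<in> outcome e \<longleftrightarrow> b i"
  shows "\<exists>n. \<forall>T. agree i T (outcome e) \<and> (i \<in> T \<longleftrightarrow> i \<notin> outcome e) \<longrightarrow> \<not> live e n (Suc i) T"
proof -
  obtain N where N: "\<And>n. n \<ge> N \<Longrightarrow> guess e n i = outcome e \<inter> {..<i}"
    using guess_tendsto by blast
  obtain M where M: "\<And>n. n \<ge> M \<Longrightarrow> guess e n (Suc i) = outcome e \<inter> {..<Suc i}"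
    using guess_tendsto by blast
  obtain K where K: "\<And>n. n \<ge> K \<Longrightarrow> a i n = b i"
    using lim_a by blast
  define n where "n = max N (max M K)"
  have n: "guess e n i = outcome e \<inter> {..<i}" "guess e n (Suc i) = outcome e \<inter> {..<Suc i}"
    "a i n = b i"
    using N M K by (simp_all add: n_def)
  \<comment> \<open>This extension has at \<open>i\<close> the bit opposite to \<open>b i\<close>,
    which is preferred at stage \<open>n\<close>. As it is not chosen, it is dead.\<close>
  let ?T = "if b i then outcome e \<inter> {..<i} else insert i (outcome e \<inter> {..<i})"
  have dead: "\<not> live e n (Suc i) ?T"
  proof
    assume "live e n (Suc i) ?T"
    then have "i \<in> guess e n (Suc i) \<longleftrightarrow> \<not> b i"
      by (auto simp: guess_Suc n(1,3) split: if_splits)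
    then show False using assms n(2) by auto
  qed
  have "\<not> live e n (Suc i) T" if "agree i T (outcome e)" "i \<in> T \<longleftrightarrow> i \<notin> outcome e" for T
  proof -
    have "agree (Suc i) T ?T"
      using that assms by (auto simp: agree_def less_Suc_eq)
    then show ?thesis using dead live_cong by blast
  qed
  then show ?thesis by blast
qed

lemma outcome_recfun:
  assumes live: "\<And>n. live e n 0 {}" and b: "\<And>i. j \<le> i \<Longrightarrow> i \<in> outcome e \<longleftrightarrow> b i"
  shows "recfun (\<lambda>i. i \<in> outcome e)"
proof -
  let ?Z = "outcome e"
  define c where "c = set_encode (?Z \<inter> {..<j})"
  have c: "set_decode c = ?Z \<inter> {..<j}" by (simp add: c_def)
  \<comment> \<open>Here \<open>w\<close> codes a stage and a string. The length
    \<open>Suc (i + j)\<close> reaches past the fixed prefix \<open>c\<close> and past bit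
    \<open>i\<close>; all other strings of this length with that prefix must be dead at the
    stage.\<close>
  define P where "P i w \<longleftrightarrow> matches j (arg w) c \<and>
    (\<forall>y<2 ^ Suc (i + j). matches j y c \<longrightarrow> \<not> matches (Suc (i + j)) y (arg w) \<longrightarrow>
      \<not> alive e (tag w) (history e (tag w)) (Suc (i + j)) y)" for i w
  have "recfun (\<lambda>z. P (fst z) (snd z))"
    unfolding P_def by (intro recfun_intros)
  moreover have ex: "\<exists>w. P i w" for i
  proof -
    have "\<forall>k. \<exists>n. j \<le> k \<longrightarrow>
        (\<forall>T. agree k T ?Z \<and> (k \<in> T \<longleftrightarrow> k \<notin> ?Z) \<longrightarrow> \<not> live e n (Suc k) T)"
      using opposite_dies[OF b] by blast
    then obtain d where d: "\<And>k T. j \<le> k \<Longrightarrow> agree k T ?Z \<Longrightarrow> (k \<in> T \<longleftrightarrow> k \<notin> ?Z) \<Longrightarrow>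
        \<not> live e (d k) (Suc k) T"
      by metis
    \<comment> \<open>A competitor first differs from the outcome at some \<open>k\<close> between
      \<open>j\<close> and \<open>i + j\<close> and is dead from stage \<open>d k\<close>
      on.\<close>
    define n where "n = Max (d ` {..i + j})"
    define z where "z = set_encode (?Z \<inter> {..<Suc (i + j)})"
    have z: "set_decode z = ?Z \<inter> {..<Suc (i + j)}" by (simp add: z_def)
    have "\<not> live e n (Suc (i + j)) (set_decode y)"
      if y: "agree j (set_decode y) ?Z" "\<not> agree (Suc (i + j)) (set_decode y) ?Z" for y
    proof -
      let ?Q = "\<lambda>k. k < Suc (i + j) \<and> (k \<in> set_decode y \<longleftrightarrow> k \<notin> ?Z)"
      have "\<exists>k. ?Q k"
        using y(2) unfolding agree_def by blast
      then obtain k where Q: "?Q k" "\<And>l. l < k \<Longrightarrow> \<not> ?Q l"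
        unfolding exists_least_iff[of ?Q] by blast
      then have k: "k < Suc (i + j)" "k \<in> set_decode y \<longleftrightarrow> k \<notin> ?Z"
        by blast+
      have least: "l \<in> set_decode y \<longleftrightarrow> l \<in> ?Z" if "l < k" for l
        using Q(2)[OF that] less_trans[OF that k(1)] by blast
      have "j \<le> k" using y(1) k(2) unfolding agree_def by (meson not_le)
      then have "\<not> live e (d k) (Suc k) (set_decode y)"
        using k least by (intro d) (auto simp: agree_def)
      moreover have "d k \<le> n" using k(1) by (auto simp: n_def)
      ultimately show ?thesis
        using k(1) live_antimono live_shorter by (meson Suc_leI)
    qed
    then have "P i (prod_encode (n, z))"
      unfolding P_def matches_iff alive_iff c z prod_encode_inverse fst_conv snd_conv
      by (auto simp: agree_def)
    then show ?thesis by blast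
  qed
  ultimately have "recfun (\<lambda>i. LEAST w. P i w)"
    by (rule recfun_Least)
  then have "recfun (\<lambda>i. \<not> even (arg (LEAST w. P i w) div 2 ^ i))"
    by (intro recfun_intros)
  moreover have "\<not> even (arg (LEAST w. P i w) div 2 ^ i) \<longleftrightarrow> i \<in> ?Z" for i
  proof -
    define w where "w = (LEAST w. P i w)"
    have w: "P i w" unfolding w_def using ex by (rule LeastI_ex)
    define z where "z = set_encode (?Z \<inter> {..<Suc (i + j)})"
    have z: "set_decode z = ?Z \<inter> {..<Suc (i + j)}" "z < 2 ^ Suc (i + j)"
      unfolding z_def by (simp, rule set_encode_less) simp
    have "agree (Suc (i + j)) (set_decode z) ?Z" by (auto simp: z agree_def)
    \<comment> \<open>The outcome's own prefix never dies, so it is the only string that the search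
      can single out.\<close>
    then have "live e n (Suc (i + j)) (set_decode z)" for n
      using live_outcome[OF live] live_cong by blast
    moreover have "matches j z c"
      unfolding matches_iff z c by (auto simp: agree_def)
    ultimately have "matches (Suc (i + j)) z (arg w)"
      using w z(2) unfolding P_def alive_iff by blast
    then have "i \<in> set_decode z \<longleftrightarrow> i \<in> set_decode (arg w)"
      unfolding matches_iff agree_def by simp
    then have "i \<in> set_decode (arg w) \<longleftrightarrow> i \<in> ?Z"
      by (simp add: z)
    then show ?thesis
      unfolding w_def set_decode_def by simp
  qed
  ultimately show ?thesis by simp
qed

end

section \<open>Density-1-bounding\<close>

text \<open>By Shoenfield's limit lemma these are the sets computable from the halting
  problem.\<close>

definition limit_computable :: "nat set \<Rightarrow> bool" where
  "limit_computable X \<longleftrightarrow>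
     (\<exists>f :: nat \<Rightarrow> nat \<Rightarrow> bool. recfun (\<lambda>z. f (fst z) (snd z)) \<and>
       (\<forall>i. \<exists>N. \<forall>n\<ge>N. f i n \<longleftrightarrow> i \<in> X))"

lemma recfun_computable:
  assumes "recfun (\<lambda>i. i \<in> X)"
  shows "computable X"
proof -
  obtain p where p: "oracle_free p" "\<And>Y i. eval p Y [enc i] = Some (enc (i \<in> X))"
    by (rule recfunE[OF assms], rule that)
  have "(\<lambda>i. Some (of_bool (i \<in> X))) = functional p {}"
    using p(2) by (simp add: functional_def fun_eq_iff enc_bool)
  then show ?thesis
    unfolding computable_def partial_computable_def using p(1) by blast
qed

text \<open>The finite table is stored in the binary digits of \<open>set_encode F\<close>.\<close>

lemma recfun_finite_modification:
  assumes "recfun P" "recfun i" "finite F"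
  shows "recfun (\<lambda>x. if i x < (j :: nat) then i x \<in> F else P x)"
proof -
  have "recfun (\<lambda>x. if i x < j then \<not> even (set_encode F div 2 ^ i x) else P x)"
    by (intro recfun_intros assms)
  moreover have "\<not> even (set_encode F div 2 ^ k) \<longleftrightarrow> k \<in> F" for k
    using set_encode_inverse[OF assms(3)] unfolding set_decode_def by blast
  ultimately show ?thesis by (simp only:)
qed

section \<open>Disagreement with almost all strings\<close>

context strategy
begin

text \<open>The outcome is limit computable, so agreement from \<open>j\<close> on makes
  \<open>X\<close> limit computable. Then \<open>b\<close> is \<open>X\<close>,
  \<open>outcome_recfun\<close> makes the outcome computable, and \<open>X\<close> differs from it
  only finitely.\<close>

lemma outcome_differs:
  assumes "\<not> computable X" "limit_computable X \<Longrightarrow> \<forall>i. b i \<longleftrightarrow> i \<in> X" "\<And>n. live e n 0 {}"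
  shows "\<exists>i\<ge>j. i \<in> X \<longleftrightarrow> i \<notin> outcome e"
proof (rule ccontr)
  assume "\<not> ?thesis"
  then have eq: "i \<in> X \<longleftrightarrow> i \<in> outcome e" if "j \<le> i" for i
    using that by blast
  let ?f = "\<lambda>i n. if i < j then i \<in> X \<inter> {..<j} else i \<in> guess e n (Suc i)"
  have "\<exists>N. \<forall>n\<ge>N. ?f i n \<longleftrightarrow> i \<in> X" for i
  proof -
    obtain N where N: "\<And>n. n \<ge> N \<Longrightarrow> guess e n (Suc i) = outcome e \<inter> {..<Suc i}"
      using guess_tendsto by blast
    have "?f i n \<longleftrightarrow> i \<in> X" if "n \<ge> N" for n
      using eq[of i] N[OF that] by (cases "i < j") simp_all
    then show ?thesis by blast
  qed
  moreover have "recfun (\<lambda>z. ?f (fst z) (snd z))"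
    by (intro recfun_finite_modification recfun_intros) simp
  ultimately have "limit_computable X"
    unfolding limit_computable_def by (intro exI[of _ ?f]) blast
  then have "i \<in> outcome e \<longleftrightarrow> b i" if "j \<le> i" for i
    using assms(2) eq[OF that] by blast
  then have "recfun (\<lambda>i. i \<in> outcome e)"
    using outcome_recfun assms(3) by blast
  then have "recfun (\<lambda>i. if i < j then i \<in> X \<inter> {..<j} else i \<in> outcome e)"
    by (intro recfun_finite_modification recfun_intros) auto
  moreover have "(if i < j then i \<in> X \<inter> {..<j} else i \<in> outcome e) \<longleftrightarrow> i \<in> X" for i
    using eq[of i] by (cases "i < j") simp_all
  ultimately have "recfun (\<lambda>i. i \<in> X)"
    by (simp only:)
  then show False
    using recfun_computable assms(1) by blast
qed

text \<open>
  A reader who only knows the bits of \<open>X\<close> from \<open>j\<close> on still sees that almost no block of the row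
  is removed.
\<close>

lemma eventually_visibly_kept:
  assumes "\<not> computable X" "limit_computable X \<Longrightarrow> \<forall>i. b i \<longleftrightarrow> i \<in> X"
  shows "\<exists>N. \<forall>n\<ge>N. live e n 0 {} \<longrightarrow>
    (\<exists>i\<ge>j. i < lev e n \<and> (i \<in> X \<longleftrightarrow> i \<notin> guess e n (lev e n)))"
proof (cases "\<forall>n. live e n 0 {}")
  case False
  then show ?thesis using live_antimono by blast
next
  case True
  then obtain i where i: "i \<ge> j" "i \<in> X \<longleftrightarrow> i \<notin> outcome e"
    using outcome_differs assms by blast
  obtain N where N: "\<And>n. n \<ge> N \<Longrightarrow> guess e n (Suc i) = outcome e \<inter> {..<Suc i}"
    using guess_tendsto by blast
  \<comment> \<open>Otherwise almost all blocks would be touched and the row would die.\<close>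
  have "\<exists>m\<ge>k. \<forall>s. \<not> touched e m s" for k
    using dead_if_all_touched True by blast
  then obtain M where M: "\<And>n. n \<ge> M \<Longrightarrow> i < lev e n"
    using lev_tendsto_infinity by blast
  have "\<exists>i\<ge>j. i < lev e n \<and> (i \<in> X \<longleftrightarrow> i \<notin> guess e n (lev e n))" if n: "n \<ge> max N M" for n
  proof -
    have "i < lev e n" using M n by simp
    moreover from this have "i \<in> guess e n (lev e n) \<longleftrightarrow> i \<in> guess e n (Suc i)"
      using agree_guess[of "Suc i" "lev e n" e n] by (auto simp: agree_def)
    moreover have "i \<in> guess e n (Suc i) \<longleftrightarrow> i \<in> outcome e"
      using N[of n] n by simp
    ultimately show ?thesis using i by blast
  qed
  then show ?thesis by blast
qed

section \<open>The density-1 real and its reduction\<close>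

definition kept :: "nat set \<Rightarrow> nat set" where
  "kept X = {m. \<not> removed X (row m) (blk m)}"

text \<open>Row \<open>code p\<close> defeats \<open>p\<close>: a correct \<open>p\<close> converges
  to 1 on a density-1 set, touches almost all blocks of that row and so gives value 1 on an element
  of a removed block.\<close>

lemma kept_not_generically_computable:
  assumes "density_one (kept X)"
  shows "\<not> generically_computable (kept X)"
proof
  assume "generically_computable (kept X)"
  then obtain p where p: "oracle_free p" and gen: "generic_computation (functional p {}) (kept X)"
    unfolding generically_computable_def partial_computable_def by blast
  define W where "W = dom (functional p {}) \<inter> kept X"
  have "density_one W"
    unfolding W_def using gen assms density_one_Int unfolding generic_computation_def by blast
  then obtain n0 where n0: "\<And>n. n \<ge> n0 \<Longrightarrow> \<exists>m\<in>W. 0 < m \<and> row m = code p \<and> blk m = n"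
    using density_one_meets_block by blast
  have "\<exists>s. touched (code p) n s" if n: "n \<ge> n0" for n
  proof -
    obtain m where m: "m \<in> W" "row m = code p" "blk m = n"
      using n0[OF n] by blast
    then have "functional p {} m = Some 1"
      using gen unfolding generic_computation_def W_def by auto
    then obtain s where "enumerated (code p) m s"
      using enumerated_code[OF p] unfolding functional_def by blast
    then have "touched (code p) n (max s (Suc m))"
      unfolding touched_def using m by (intro exI[of _ m]) (auto intro: enumerated_mono)
    then show ?thesis by blast
  qed
  from removed_if_all_touched[OF this]
  obtain m s where m: "row m = code p" "enumerated (code p) m s" "removed X (code p) (blk m)"
    by blast
  then have "functional p {} m = Some 1"
    using enumerated_code[OF p] unfolding functional_def by blast
  moreover from this have "functional p {} m = Some (of_bool (m \<in> kept X))"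
    using gen unfolding generic_computation_def by blast
  ultimately have "m \<in> kept X"
    by (cases "m \<in> kept X") simp_all
  then show False using m unfolding kept_def by simp
qed

text \<open>The second component codes an element \<open>q\<close> and a time \<open>l\<close>. The
  triple queried assigns to \<open>q\<close> the bit opposite to that of the string at
  \<open>blk q\<close>, so a positive answer exhibits a disagreement.\<close>

definition query :: "nat \<times> nat \<Rightarrow> nat" where
  "query z = prod_encode (tag (snd z), prod_encode (of_bool (blk (tag (snd z)) \<notin>
     guess (row (fst z)) (blk (fst z)) (lev (row (fst z)) (blk (fst z)))), arg (snd z)))"

text \<open>The first disjunct covers stages without removals. The number 0 is excluded because it
  has \<open>blk 0 = 0\<close> but never lies in \<open>R_tilde X\<close>.\<close>

definition accepts :: "nat \<times> nat \<times> bool \<Rightarrow> bool" where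
  "accepts z \<longleftrightarrow> \<not> alive (row (fst z)) (blk (fst z)) (history (row (fst z)) (blk (fst z))) 0 0 \<or>
     0 < tag (fst (snd z)) \<and> blk (tag (fst (snd z))) < lev (row (fst z)) (blk (fst z)) \<and>
     snd (snd z)"

lemma R_tilde_iff: "0 < q \<Longrightarrow> q \<in> R_tilde X \<longleftrightarrow> blk q \<in> X"
  unfolding R_tilde_def using power_blk_le less_power_blk blk_eqI by auto

lemma kept_generic_reducible:
  assumes "\<not> computable X" "limit_computable X \<Longrightarrow> \<forall>i. b i \<longleftrightarrow> i \<in> X"
  shows "kept X \<le>\<^sub>g R_tilde X"
proof -
  have "recfun query"
    unfolding query_def of_bool_def by (intro recfun_intros)
  moreover have "recfun accepts"
    unfolding accepts_def by (intro recfun_intros)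
  ultimately obtain p where p: "\<And>Y m. functional p Y m =
      (if \<exists>y. accepts (m, y, query (m, y) \<in> Y) then Some 1 else None)"
    using oracle_search by metis
  have "generic_computation (functional p (triple_encode ` P)) (kept X)"
    if P: "generic_oracle P (R_tilde X)" for P
  proof -
    have bit: "x = of_bool (q \<in> R_tilde X)" if "(q, x, l) \<in> P" for q x l
      using P that unfolding generic_oracle_def partial_oracle_def by blast
    have mem: "prod_encode (q, prod_encode (x, l)) \<in> triple_encode ` P \<longleftrightarrow> (q, x, l) \<in> P" for q x l
      by (force simp: triple_encode_def prod_encode_eq image_iff)
    have accepts_iff: "(\<exists>y. accepts (m, y, query (m, y) \<in> triple_encode ` P)) \<longleftrightarrow>
      \<not> live e n 0 {} \<or> (\<exists>q l. 0 < q \<and> blk q < lev e n \<and>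
        (q, of_bool (blk q \<notin> guess e n (lev e n)), l) \<in> P)"
      if "e = row m" "n = blk m" for m e n
    proof -
      define R where "R q l \<longleftrightarrow> 0 < q \<and> blk q < lev e n \<and>
        (q, of_bool (blk q \<notin> guess e n (lev e n)), l) \<in> P" for q l
      have "accepts (m, y, query (m, y) \<in> triple_encode ` P) \<longleftrightarrow>
          \<not> live e n 0 {} \<or> R (tag y) (arg y)" for y
        by (simp add: accepts_def query_def alive_iff mem that R_def)
      moreover have "(\<exists>y. R (tag y) (arg y)) \<longleftrightarrow> (\<exists>q l. R q l)"
        by (metis fst_conv prod_encode_inverse snd_conv)
      ultimately have "(\<exists>y. accepts (m, y, query (m, y) \<in> triple_encode ` P)) \<longleftrightarrow>
          \<not> live e n 0 {} \<or> (\<exists>q l. R q l)"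
        by blast
      then show ?thesis unfolding R_def .
    qed
    let ?\<psi> = "functional p (triple_encode ` P)"
    have dom_iff: "m \<in> dom ?\<psi> \<longleftrightarrow> (\<exists>y. accepts (m, y, query (m, y) \<in> triple_encode ` P))" for m
      by (simp add: p dom_def)
    have sound: "m \<in> kept X" if "m \<in> dom ?\<psi>" for m
    proof -
      define e n where "e = row m" and "n = blk m"
      have "\<not> live e n 0 {} \<or> (\<exists>q l. 0 < q \<and> blk q < lev e n \<and>
          (q, of_bool (blk q \<notin> guess e n (lev e n)), l) \<in> P)"
        using that unfolding dom_iff accepts_iff[OF e_def n_def] .
      moreover have "\<not> agree (lev e n) X (guess e n (lev e n))"
        if "0 < q" "blk q < lev e n" "(q, of_bool (blk q \<notin> guess e n (lev e n)), l) \<in> P" for q l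
        using bit[OF that(3)] R_tilde_iff[OF that(1)] that(2)
        by (auto simp: agree_def of_bool_eq_iff)
      ultimately show ?thesis
        unfolding kept_def removed_def e_def n_def by blast
    qed
    \<comment> \<open>A single element of block \<open>i\<close> in the domain of the oracle reveals
      whether \<open>i \<in> X\<close>; row 0 supplies one for almost all \<open>i\<close>.\<close>
    obtain j where j: "\<And>i. i \<ge> j \<Longrightarrow> \<exists>q\<in>oracle_dom P. 0 < q \<and> row q = 0 \<and> blk q = i"
      using P density_one_meets_block unfolding generic_oracle_def by blast
    have "density_one (dom ?\<psi>)"
    proof (rule density_oneI_rows)
      fix e
      obtain N where N: "\<And>n. n \<ge> N \<Longrightarrow> live e n 0 {} \<Longrightarrow>
          \<exists>i\<ge>j. i < lev e n \<and> (i \<in> X \<longleftrightarrow> i \<notin> guess e n (lev e n))"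
        using eventually_visibly_kept[OF assms] by blast
      have "m \<in> dom ?\<psi>" if m: "row m = e" "N \<le> blk m" for m
      proof -
        have "\<exists>q l. 0 < q \<and> blk q < lev e (blk m) \<and>
            (q, of_bool (blk q \<notin> guess e (blk m) (lev e (blk m))), l) \<in> P"
          if live: "live e (blk m) 0 {}"
        proof -
          obtain i where i: "i \<ge> j" "i < lev e (blk m)"
            "i \<in> X \<longleftrightarrow> i \<notin> guess e (blk m) (lev e (blk m))"
            using N[OF m(2) live] by blast
          obtain q x l where q: "(q, x, l) \<in> P" "0 < q" "blk q = i"
            using j[OF i(1)] unfolding oracle_dom_def by blast
          have "x = of_bool (blk q \<notin> guess e (blk m) (lev e (blk m)))"
            using bit[OF q(1)] R_tilde_iff[OF q(2)] i(3) q(3) by simp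
          then show ?thesis using q i(2) by blast
        qed
        then show ?thesis
          unfolding dom_iff accepts_iff[OF m(1)[symmetric] refl] by blast
      qed
      then show "\<exists>N. \<forall>m. row m = e \<and> N \<le> blk m \<longrightarrow> m \<in> dom ?\<psi>" by blast
    qed
    moreover have "?\<psi> m = Some (of_bool (m \<in> kept X))" if "m \<in> dom ?\<psi>" for m
      using sound[OF that] that by (auto simp: p split: if_splits)
    ultimately show ?thesis unfolding generic_computation_def by blast
  qed
  then show ?thesis unfolding generic_reducible_def by blast
qed

text \<open>This is the case \<open>j = 0\<close>, in which all bits of \<open>X\<close> are
  visible.\<close>

lemma density_one_kept:
  assumes "\<not> computable X" "limit_computable X \<Longrightarrow> \<forall>i. b i \<longleftrightarrow> i \<in> X"
  shows "density_one (kept X)"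
proof (rule density_oneI_rows)
  fix e
  obtain N where "\<And>n. n \<ge> N \<Longrightarrow> live e n 0 {} \<Longrightarrow>
      \<exists>i\<ge>0. i < lev e n \<and> (i \<in> X \<longleftrightarrow> i \<notin> guess e n (lev e n))"
    using eventually_visibly_kept[OF assms] by blast
  then have "m \<in> kept X" if "row m = e" "N \<le> blk m" for m
    using that unfolding kept_def removed_def agree_def by blast
  then show "\<exists>N. \<forall>m. row m = e \<and> N \<le> blk m \<longrightarrow> m \<in> kept X" by blast
qed

end

theorem proposition4p6:
  fixes A :: "nat set"
  assumes "\<not> computable A"
  shows "density_one_bounding (R_tilde A)"
proof -
  obtain a b where "strategy a b" and b: "limit_computable A \<Longrightarrow> \<forall>i. b i \<longleftrightarrow> i \<in> A"
  proof (cases "limit_computable A")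
    case True
    then obtain f :: "nat \<Rightarrow> nat \<Rightarrow> bool"
      where "recfun (\<lambda>z. f (fst z) (snd z))" "\<forall>i. \<exists>N. \<forall>n\<ge>N. f i n \<longleftrightarrow> i \<in> A"
      unfolding limit_computable_def by blast
    then have "strategy f (\<lambda>i. i \<in> A)" by unfold_locales blast+
    then show ?thesis using that by blast
  next
    case False
    \<comment> \<open>Any computable convergent approximation serves here, the condition on
      \<open>b\<close> being vacuous.\<close>
    have "strategy (\<lambda>_ _. False) (\<lambda>_. False)"
      by unfold_locales (auto intro: recfun_intros)
    then show ?thesis using that False by blast
  qed
  then interpret strategy a b by simp
  show ?thesis
    unfolding density_one_bounding_def
    using kept_not_generically_computable density_one_kept[OF assms b]
      kept_generic_reducible[OF assms b] by blast
qed

end
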